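(* Let $n,k$ be integers with $n>2$ and $1\le k<n$, and let $S_{n,k}$, $\varphi_{n,k}$, $\omega_n$, $P_{n,k}$, $\Omega_{n,k}$, $J$, $\Sigma_n$ be as defined in the context. Then: 1. $S_{n,k}$ has an analytic continuation to $\Omega_{n,k}$ (i.e. there is a holomorphic function on $\Omega_{n,k}$, again denoted $S_{n,k}$, agreeing with the real function $S_{n,k}$ on $[0,\varphi_{n,k})$), and this continuation is a conformal equivalence (biholomorphism) from $\Omega_{n,k}$ onto $\Sigma_n$. 2. $S_{n,k}:\Omega_{n,k}\to\Sigma_n$ has a continuous extension $\tilde S_{n,k}$ (to $\overline{\Omega}_{n,1}$ if $k=1$, and to $\overline{\Omega}_{n,k}\setminus\bigcup_j\{\omega_n^jP_{n,k}\}$ if $k>1$) with values in $\mathbb{C}$ and with $\tilde S_{n,k}(\omega_n^j\varphi_{n,k})=\omega_n^j$ for all $j\in\mathbb{Z}$; moreover, (a) $\tilde S_{n,1}$ maps $\partial\Omega_{n,1}\setminus\bigcup_j\{\omega_n^j\varphi_{n,1}\}$ two-to-one onto $\bigcup_j\omega_n^j\cdot\mathring{J}$; (b) for $k>1$, $\tilde S_{n,k}$ maps $\partial\Omega_{n,k}\setminus\bigcup_j\{\omega_n^j\varphi_{n,k},\ \omega_n^jP_{n,k}\}$ two-to-one onto $\bigcup_j\omega_n^j\cdot\mathring{J}$. (Two-to-one means that every point of the target set has exactly two preimages in the indicated source set.) 3. $\Omega_{n,k}$ is maximal among domains containing $0$ on which $S_{n,k}$ is univalent: if $D\supsetneq\Omega_{n,k}$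 is a domain (open connected set) and $S_{n,k}$ continues analytically to $D$, then the continuation is not injective on $D$.
   Context: Let $n,k$ be integers with $n>2$, $1\le k<n$. For $y\in[0,1]$ let $F_{n,k}(y)=\int_0^y(1-x^n)^{-k/n}\,dx$, let $\varphi_{n,k}=F_{n,k}(1)$ (a finite number), and let $S_{n,k}:[0,\varphi_{n,k}]\to[0,1]$ be the inverse function of $F_{n,k}$. Let $\omega_n=e^{2\pi i/n}$, $O=0$, $A_{n,k}=\varphi_{n,k}$, $B_{n,k}=\varphi_{n,k}\omega_n$ (points of $\mathbb{C}$). Closed sets $\Pi_{n,k}$. For $k=1$: $\Pi_{n,1}$ is the closed set whose boundary is the union of the two rays $\{\varphi_{n,1}+te^{i\pi/n}: t\ge0\}$ and $\{\varphi_{n,1}\omega_n+te^{i\pi/n}:t\ge0\}$ and the two segments $OA_{n,1}$, $OB_{n,1}$, and whose interior is the component of $\mathbb{C}\setminus\partial\Pi_{n,1}$ containing $\{te^{i\pi/n}:t>0\}$. For $k>1$: let $P_{n,k}$ be the point on the ray $\{te^{i\pi/n}:t>0\}$ (the bisector of $\angle A_{n,k}OB_{n,k}$) such that the segment from $A_{n,k}$ to $P_{n,k}$ has angle of inclination $k\pi/n$; explicitly $P_{n,k}=\varphi_{n,k}e^{i\pi/n}\left(\cos\frac{\pi}{n}+\sin\frac{\pi}{n}\cot\frac{(k-1)\pi}{n}\right)$. Then $\Pi_{n,k}$ is the compact set enclosed by the polygon $OA_{n,k}P_{n,k}B_{n,k}$ (possibly nonconvex, or with degenerate vertex $P_{n,k}$).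 $\Omega_{n,k}$ is the interior of $\bigcup_{j=0}^{n-1}\omega_n^j\cdot\Pi_{n,k}$. Let $J=[1,\infty)$, $\mathring{J}=(1,\infty)$, and $\Sigma_n=\mathbb{C}\setminus\bigcup_{j=0}^{n-1}\omega_n^j\cdot J$. Univalent means holomorphic and injective. *)

theory Defs
  imports "HOL-Complex_Analysis.Complex_Analysis"
begin

definition F_int :: "nat \<Rightarrow> nat \<Rightarrow> real \<Rightarrow> real" where
  "F_int n k y = integral {0..y} (\<lambda>x. (1 - x ^ n) powr (- (real k / real n)))"

definition phi :: "nat \<Rightarrow> nat \<Rightarrow> real" where
  "phi n k = F_int n k 1"

text \<open>The inverse of \<open>F_int n k : [0, 1] \<rightarrow> [0, phi n k]\<close>; only its values on
  \<open>[0, phi n k]\<close> are meaningful.\<close>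

definition S_inv :: "nat \<Rightarrow> nat \<Rightarrow> real \<Rightarrow> real" where
  "S_inv n k = inv_into {0..1} (F_int n k)"

definition omega :: "nat \<Rightarrow> complex" where
  "omega n = cis (2 * pi / real n)"

definition pt_A :: "nat \<Rightarrow> nat \<Rightarrow> complex" where
  "pt_A n k = complex_of_real (phi n k)"

definition pt_B :: "nat \<Rightarrow> nat \<Rightarrow> complex" where
  "pt_B n k = complex_of_real (phi n k) * omega n"

text \<open>Only used for \<open>1 < k\<close>; for \<open>k = 1\<close> the cotangent is undefined.\<close>

definition pt_P :: "nat \<Rightarrow> nat \<Rightarrow> complex" where
  "pt_P n k = complex_of_real
      (phi n k * (cos (pi / real n) + sin (pi / real n) * cot ((real k - 1) * pi / real n)))
      * cis (pi / real n)"

text \<open>The explicit point above is the one on the bisector for which the segment from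
  \<open>pt_A n k\<close> has inclination \<open>k \<pi> / n\<close>.\<close>

lemma pt_P_minus_pt_A:
  assumes "1 < k" "k < n"
  shows "pt_P n k - pt_A n k =
    complex_of_real (phi n k * sin (pi / real n) / sin ((real k - 1) * pi / real n))
      * cis (real k * pi / real n)"
proof -
  define a where "a = pi / real n"
  define b where "b = (real k - 1) * pi / real n"
  have "(real k - 1) * pi < real n * pi"
    using assms by (intro mult_strict_right_mono) auto
  then have "b < pi" "b > 0"
    using assms by (auto simp: b_def divide_less_eq mult.commute)
  then have sb: "sin b \<noteq> 0" using sin_gt_zero[of b] by auto
  have k: "real k * pi / real n = a + b"
    by (simp add: a_def b_def add_divide_distrib[symmetric] algebra_simps)
  have sq: "cos a * (cos a * x) + sin a * (sin a * x) = x" for x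
    using arg_cong[OF sin_cos_squared_add3[of a], of "\<lambda>t. t * x"]
    by (simp only: distrib_right mult.assoc mult_1)
  show ?thesis
    unfolding pt_P_def pt_A_def k a_def[symmetric] b_def[symmetric]
    using sb
    by (simp add: complex_eq_iff cot_def cos_add sin_add field_simps sq)
qed

definition ray :: "complex \<Rightarrow> complex \<Rightarrow> complex set" where
  "ray p v = {p + complex_of_real t * v | t. 0 \<le> t}"

definition Pi_boundary :: "nat \<Rightarrow> nat \<Rightarrow> complex set" where
  "Pi_boundary n k =
    (if k = 1
     then ray (pt_A n k) (cis (pi / real n)) \<union> ray (pt_B n k) (cis (pi / real n))
          \<union> closed_segment 0 (pt_A n k) \<union> closed_segment 0 (pt_B n k)
     else closed_segment 0 (pt_A n k) \<union> closed_segment (pt_A n k) (pt_P n k)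
          \<union> closed_segment (pt_P n k) (pt_B n k) \<union> closed_segment (pt_B n k) 0)"

text \<open>A closed set is the union of its boundary and its interior. For \<open>k = 1\<close> the interior is
  the component of the complement of the boundary that contains the open bisecting ray; that
  ray is connected and misses the boundary, so its point \<open>cis (\<pi> / n)\<close> determines the
  component.\<close>

definition Pi_set :: "nat \<Rightarrow> nat \<Rightarrow> complex set" where
  "Pi_set n k = Pi_boundary n k \<union>
    (if k = 1 then connected_component_set (- Pi_boundary n k) (cis (pi / real n))
     else inside (Pi_boundary n k))"

text \<open>The union of the sets \<open>omega n ^ j \<cdot> X\<close> over all integers \<open>j\<close>; as \<open>omega n ^ n = 1\<close>, the
  exponents \<open>0, \<dots>, n - 1\<close> suffice.\<close>

definition rotations :: "nat \<Rightarrow> complex set \<Rightarrow> complex set" where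
  "rotations n X = (\<Union>j<n. (\<lambda>z. omega n ^ j * z) ` X)"

definition Omega :: "nat \<Rightarrow> nat \<Rightarrow> complex set" where
  "Omega n k = interior (rotations n (Pi_set n k))"

definition Sigma_slit :: "nat \<Rightarrow> complex set" where
  "Sigma_slit n = - rotations n (complex_of_real ` {1..})"

definition continues_S :: "nat \<Rightarrow> nat \<Rightarrow> complex set \<Rightarrow> (complex \<Rightarrow> complex) \<Rightarrow> bool" where
  "continues_S n k D f \<longleftrightarrow>
    open D \<and> connected D \<and> complex_of_real ` {0..<phi n k} \<subseteq> D \<and> f holomorphic_on D \<and>
    (\<forall>x\<in>{0..<phi n k}. f (complex_of_real x) = complex_of_real (S_inv n k x))"

definition biholomorphism ::
    "complex set \<Rightarrow> complex set \<Rightarrow> (complex \<Rightarrow> complex) \<Rightarrow> bool" where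
  "biholomorphism U V f \<longleftrightarrow>
    bij_betw f U V \<and> f holomorphic_on U \<and> inv_into U f holomorphic_on V"

definition two_to_one_onto :: "('a \<Rightarrow> 'b) \<Rightarrow> 'a set \<Rightarrow> 'b set \<Rightarrow> bool" where
  "two_to_one_onto g X Y \<longleftrightarrow> g ` X = Y \<and> (\<forall>y\<in>Y. card {x \<in> X. g x = y} = 2)"

end

(* The half-sector 0 <= arg z <= pi/n is a fundamental domain of the dihedral group of order 2n.
   On it (1 - z^n)^(-k/n) takes values in a sector of angle k pi/n < pi, so its primitive G is
   injective up to the boundary (Noshiro-Warschawski), and integrating along suitable directions
   shows that G maps into the triangle (half-strip if k = 1) bounded by the images of the three
   edges. A connectedness argument gives surjectivity, the far vertex P being the limit at
   infinity. Reflections and rotations carry this to the whole star; on the slit plane the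
   resulting inverse is holomorphic because there the reflected pieces of G agree with the
   primitive F of the principal branch. Each outer edge is mapped to one side of a slit, so every
   slit point has two boundary preimages p and p'. A univalent extension past p would by the open
   mapping theorem send a neighbourhood of p onto a neighbourhood of the slit point, leaving no
   room for the values near p'. *)

theory Submission
  imports Defs
begin

text \<open>On the full sector between neighbouring slits the argument of (1 - z^n)^(-k/n) sweeps an
  interval of length 2 k pi / n, which may exceed pi, and the polygon may be nonconvex. Both defects
  vanish on the half-sector, whose image region is always an intersection of three half-planes;
  hence the dihedral instead of the cyclic group, and hence heights above lines as the basic
  measure. The price is gluing. The inverse of \<open>G\<close> extends consistently by symmetry
  only because a point whose image lies on a mirror lies on that mirror itself. The converse fails
  exactly on the slits: they lie on mirrors but their images do not, and this is the source of the
  two boundary preimages. Two branches of the same power are needed, one continuous up to the edges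
  of the closed half-sector, including the upper side of the slit, and one holomorphic across the
  mirrors off the slits. As P is only a limit at infinity, properness is replaced by an escape
  estimate away from P.\<close>

text \<open>Signed height of \<open>w\<close> above the line through \<open>0\<close> with inclination \<open>\<theta>\<close>.\<close>

definition ht :: "real \<Rightarrow> complex \<Rightarrow> real" where
  "ht \<theta> w = Im (w * cis (-\<theta>))"

lemma ht_eq: "ht \<theta> w = Im w * cos \<theta> - Re w * sin \<theta>"
  by (simp add: ht_def)

lemma ht_0 [simp]: "ht \<theta> 0 = 0"
  by (simp add: ht_def)

lemma ht_add: "ht \<theta> (z + w) = ht \<theta> z + ht \<theta> w"
  and ht_diff: "ht \<theta> (z - w) = ht \<theta> z - ht \<theta> w"
  and ht_of_real_mult: "ht \<theta> (of_real r * w) = r * ht \<theta> w"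
  by (simp_all add: ht_eq algebra_simps)

lemma ht_cis [simp]: "ht \<theta> (cis s) = sin (s - \<theta>)"
  by (simp add: ht_eq sin_diff algebra_simps)

lemma ht_of_real [simp]: "ht \<theta> (of_real r) = - (r * sin \<theta>)"
  by (simp add: ht_eq)

lemma ht_rcis: "ht \<theta> (of_real r * cis s) = r * sin (s - \<theta>)"
  by (simp add: ht_of_real_mult)

lemma ht_inner: "ht \<theta> w = inner (Complex (- sin \<theta>) (cos \<theta>)) w"
  by (simp add: ht_eq inner_complex_def)

lemma Im_inner: "Im w = inner \<i> w"
  by (simp add: inner_complex_def)

lemma continuous_on_ht [continuous_intros]: "continuous_on A f \<Longrightarrow> continuous_on A (\<lambda>x. ht \<theta> (f x))"
  unfolding ht_def by (intro continuous_intros)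

lemma ht_pos_interior:
  assumes "\<And>w. w \<in> S \<Longrightarrow> b \<le> ht \<theta> w" and "w \<in> interior S"
  shows "b < ht \<theta> w"
proof -
  obtain e where e: "e > 0" "ball w e \<subseteq> S"
    using assms(2) by (meson mem_interior)
  define v where "v = w - of_real (e / 2) * (\<i> * cis \<theta>)"
  have "dist w v = e / 2" using e by (simp add: v_def dist_norm norm_mult)
  then have "v \<in> S" using e by (auto intro!: subsetD[OF e(2)])
  then have "b \<le> ht \<theta> v" by (rule assms)
  also have "ht \<theta> (\<i> * cis \<theta>) = 1" by (simp add: ht_eq power2_eq_square[symmetric])
  then have "ht \<theta> v = ht \<theta> w - e / 2" by (simp only: v_def ht_diff ht_of_real_mult mult_1_right)
  finally show ?thesis using e by simp
qed

lemma ht_neg_interior: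
  assumes "\<And>w. w \<in> S \<Longrightarrow> ht \<theta> w \<le> b" and "w \<in> interior S"
  shows "ht \<theta> w < b"
proof -
  have *: "ht (\<theta> + pi) w = - ht \<theta> w" for w by (simp add: ht_eq)
  show ?thesis
    using ht_pos_interior[of S "-b" "\<theta> + pi" w] assms by (simp add: *)
qed

lemma Im_eq_ht: "Im w = ht 0 w"
  by (simp add: ht_eq)

section \<open>The fundamental sector\<close>

locale sc_map =
  fixes n k :: nat
  assumes n2: "2 < n" and k1: "1 \<le> k" and kn: "k < n"
begin

definition a :: real where "a = pi / real n"
definition \<beta> :: real where "\<beta> = real k / real n"

text \<open>From \<open>k < n\<close> comes \<open>real k * a + a \<le> pi\<close>: the argument
  range of the integrand and the opening of the sector together fit into a half-turn. From
  \<open>2 < n\<close> comes \<open>a \<le> pi / 3\<close>, which keeps chords of the sector away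
  from the origin.\<close>

lemma n0: "real n > 0" and a_pos: "0 < a" and na: "real n * a = pi" and a_le: "a \<le> pi / 3"
  and ka: "real k * a = \<beta> * pi" and beta_pos: "0 < \<beta>" and beta_lt: "\<beta> < 1"
  and ka1: "real k * a + a \<le> pi" and a_le_ka: "a \<le> real k * a"
proof -
  show 1: "real n > 0" using n2 by simp
  then show "0 < a" "real n * a = pi" by (auto simp: a_def)
  show "a \<le> pi / 3" using n2 unfolding a_def by (intro divide_left_mono) auto
  show "real k * a = \<beta> * pi" by (simp add: a_def \<beta>_def)
  show "0 < \<beta>" "\<beta> < 1" using k1 kn by (auto simp: \<beta>_def)
  have "(real k + 1) * a \<le> real n * a" 
    using kn \<open>0 < a\<close> by (intro mult_right_mono) auto
  then show "real k * a + a \<le> pi" using \<open>real n * a = pi\<close> by (simp add: algebra_simps)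
  show "a \<le> real k * a" using k1 \<open>0 < a\<close> by simp
qed

lemma a_lt_pi2: "a < pi / 2"
  using a_le pi_gt_zero by linarith

lemma sin_a_pos: "0 < sin a" 
  using a_pos a_lt_pi2 by (intro sin_gt_zero) auto

lemma ka_lt: "real k * a < pi" using ka1 a_pos by linarith

lemma sin_ka_pos: "0 < sin (real k * a)" 
  using a_pos a_le_ka ka_lt by (intro sin_gt_zero) auto

lemma sin_k1a_pos: assumes "k > 1" shows "0 < sin (real k * a - a)" 
proof -
  have "1 * a < real k * a" using assms a_pos by (intro mult_strict_right_mono) auto
  then show ?thesis using ka_lt a_pos by (intro sin_gt_zero) auto
qed

definition sector :: "complex set" where
  "sector = {z. 0 \<le> Im z \<and> ht a z \<le> 0}"

lemma sector_polar_intro: "\<lbrakk>0 \<le> r; 0 \<le> s; s \<le> a\<rbrakk> \<Longrightarrow> of_real r * cis s \<in> sector"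
  using a_lt_pi2 sin_ge_zero[of s] sin_ge_zero[of "a - s"] sin_minus[of "a - s"]
  unfolding sector_def mem_Collect_eq ht_rcis by (simp add: mult_nonneg_nonpos)

lemma sector_polar:
  assumes "z \<in> sector"
  obtains r s where "z = of_real r * cis s" "norm z = r" "0 \<le> s" "s \<le> a"
proof (cases "z = 0")
  case True
  then show ?thesis using that[of 0 0] a_pos by simp
next
  case False
  define s where "s = Arg z"
  have z: "z = of_real (norm z) * cis s"
    using rcis_cmod_Arg[of z] by (simp add: rcis_def s_def)
  have s: "- pi < s" "s \<le> pi" using Arg_bounded[of z] by (auto simp: s_def)
  have "0 \<le> Im z" using assms by (simp add: sector_def)
  then have s0: "0 \<le> s" using False 
    using Im_Ln_pos_le[of z] s by (simp add: s_def Arg_eq_Im_Ln)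
  have "ht a z \<le> 0" using assms by (simp add: sector_def)
  then have "norm z * sin (s - a) \<le> 0" using z by (metis ht_rcis)
  then have "sin (s - a) \<le> 0" using False by (simp add: mult_le_0_iff)
  then have "s \<le> a" using sin_gt_zero[of "s - a"] s a_pos by force
  then show ?thesis using that z s0 by blast
qed

lemma sector_of_real [simp]: "of_real x \<in> sector \<longleftrightarrow> 0 \<le> x"
  using sin_a_pos by (auto simp: sector_def zero_le_mult_iff)

lemma sector_cis_a: "0 \<le> x \<Longrightarrow> of_real x * cis a \<in> sector"
  using a_pos by (intro sector_polar_intro) auto

lemma zero_in_sector [simp]: "0 \<in> sector" and one_in_sector [simp]: "1 \<in> sector"
  using sector_of_real[of 0] sector_of_real[of 1] by simp_all

lemma closed_sector: "closed sector"
  unfolding sector_def by (intro closed_Collect_conj closed_Collect_le continuous_intros)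

lemma convex_sector: "convex sector"
  unfolding sector_def Im_inner ht_inner Collect_conj_eq
  by (intro convex_Int convex_halfspace_ge convex_halfspace_le)

lemma interior_sector: "interior sector = {z. 0 < Im z \<and> ht a z < 0}"
proof
  show "interior sector \<subseteq> {z. 0 < Im z \<and> ht a z < 0}"
    using ht_pos_interior[of sector 0 0] ht_neg_interior[of sector a 0] by (auto simp: sector_def Im_eq_ht)
  show "{z. 0 < Im z \<and> ht a z < 0} \<subseteq> interior sector"
    by (intro interior_maximal open_Collect_conj open_Collect_less continuous_intros)
       (auto simp: sector_def)
qed

lemma sector_line0: "\<lbrakk>z \<in> sector; Im z = 0\<rbrakk> \<Longrightarrow> z = of_real (Re z) \<and> 0 \<le> Re z"
  using sin_a_pos mult_neg_pos[of "Re z" "sin a"] by (cases "Re z < 0") (auto simp: sector_def ht_eq complex_eq_iff)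

lemma sector_linea:
  assumes "z \<in> sector" "ht a z = 0"
  shows "z = of_real (norm z) * cis a"
proof -
  obtain r s where rs: "z = of_real r * cis s" "norm z = r" "0 \<le> s" "s \<le> a"
    using assms(1) by (rule sector_polar)
  have "r * sin (s - a) = 0" using assms(2) rs(1) by (simp add: ht_rcis)
  then have "norm z = 0 \<or> s = a"
    using rs sin_gt_zero[of "a - s"] sin_minus[of "a - s"] a_lt_pi2 by (cases "s < a") auto
  then show ?thesis using rs by auto
qed

lemma sector_cases:
  assumes "z \<in> sector"
  obtains "z \<in> interior sector" | x where "z = of_real x" "0 \<le> x" | x where "z = of_real x * cis a" "0 \<le> x"
  using assms sector_line0[of z] sector_linea[of z] interior_sector that
  by (cases "Im z = 0"; cases "ht a z = 0") (force simp: sector_def)+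

section \<open>The dihedral group acting on the plane\<close>

text \<open>The flag selects conjugation, performed before the rotation. The index is an arbitrary
  integer, so that composition in \<open>dih_dih\<close> is plain arithmetic; the redundancy modulo
  \<open>n\<close> is handled by \<open>dih_mod\<close>.\<close>

definition dih :: "int \<Rightarrow> bool \<Rightarrow> complex \<Rightarrow> complex" where
  "dih j e z = cis (2 * a * of_int j) * (if e then cnj z else z)"

lemma dih_0 [simp]: "dih j e 0 = 0" by (simp add: dih_def)

lemma dih_id [simp]: "dih 0 False z = z" by (simp add: dih_def)

lemma norm_dih [simp]: "norm (dih j e z) = norm z" by (simp add: dih_def norm_mult)

lemma dih_dih: "dih i d (dih j e z) = dih (if d then i - j else i + j) (d \<noteq> e) z"
  by (cases d; cases e; simp add: dih_def cis_cnj cis_mult ring_distribs flip: mult.assoc)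

lemma dih_add: "dih j e (z + w) = dih j e z + dih j e w"
  and dih_diff: "dih j e (z - w) = dih j e z - dih j e w"
  by (simp_all add: dih_def algebra_simps)

lemma dist_dih [simp]: "dist (dih j e z) (dih j e w) = dist z w"
  by (simp add: dist_norm flip: dih_diff)

lemma continuous_on_dih [continuous_intros]: "continuous_on A f \<Longrightarrow> continuous_on A (\<lambda>x. dih j e (f x))"
  unfolding dih_def by (cases e) (auto intro!: continuous_intros)

lemma tendsto_dih: "(f \<longlongrightarrow> l) F \<Longrightarrow> ((\<lambda>x. dih j e (f x)) \<longlongrightarrow> dih j e l) F"
  unfolding dih_def by (cases e) (auto intro!: tendsto_intros)

definition dinv :: "int \<Rightarrow> bool \<Rightarrow> complex \<Rightarrow> complex" where
  "dinv j e = dih (if e then j else - j) e"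

lemma dinv_dih [simp]: "dinv j e (dih j e z) = z" and dih_dinv [simp]: "dih j e (dinv j e z) = z"
  by (auto simp: dinv_def dih_dih)

lemma dih_inj [simp]: "dih j e z = dih j e w \<longleftrightarrow> z = w"
  by (metis dinv_dih)

lemma continuous_on_dinv [continuous_intros]: "continuous_on A f \<Longrightarrow> continuous_on A (\<lambda>x. dinv j e (f x))"
  unfolding dinv_def by (intro continuous_intros)

lemma cis_period: "cis (2 * a * of_int (i + int n * m)) = cis (2 * a * of_int i)"
proof -
  have "2 * a * of_int (i + int n * m) = 2 * a * of_int i + 2 * pi * of_int m"
    using na by (simp add: algebra_simps)
  then show ?thesis by (simp add: complex_eq_iff cos_add sin_add)
qed

lemma dih_mod: "dih (j mod int n) e = dih j e"
proof -
  have "j = j mod int n + int n * (j div int n)" by simp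
  then have "cis (2 * a * of_int j) = cis (2 * a * of_int (j mod int n))"
    using cis_period by metis
  then show ?thesis by (simp add: dih_def fun_eq_iff)
qed

lemma omega_eq: "omega n = cis (2 * a)"
  by (simp add: omega_def a_def)

lemma omega_power: "omega n ^ j = cis (2 * a * of_int (int j))"
  unfolding omega_eq Complex.DeMoivre by (simp add: mult.commute)

lemma omega_powi: "omega n powi j = cis (2 * a * of_int j)"
  by (simp add: omega_eq cis_power_int mult.commute)

lemma rotations_iff: "w \<in> rotations n X \<longleftrightarrow> (\<exists>j::int. \<exists>z\<in>X. w = dih j False z)"
proof
  assume "w \<in> rotations n X"
  then obtain j z where "z \<in> X" "w = omega n ^ j * z" by (auto simp: rotations_def)
  then have "w = dih (int j) False z" unfolding omega_power dih_def by simp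
  then show "\<exists>j::int. \<exists>z\<in>X. w = dih j False z" using \<open>z \<in> X\<close> by blast
next
  assume "\<exists>j::int. \<exists>z\<in>X. w = dih j False z"
  then obtain j z where jz: "z \<in> X" "w = dih j False z" by blast
  define i where "i = nat (j mod int n)"
  have "int i = j mod int n" "i < n"
    using n2 by (auto simp: i_def nat_less_iff)
  moreover have "w = dih (j mod int n) False z" using jz by (simp add: dih_mod)
  ultimately have "w = omega n ^ i * z" unfolding omega_power dih_def by simp
  then show "w \<in> rotations n X"
    using jz \<open>i < n\<close> unfolding rotations_def by auto
qed



lemma dih_cover:
  obtains j e z where "z \<in> sector" "w = dih j e z"
proof -
  define \<theta> where "\<theta> = Arg2pi w"
  have w: "w = of_real (norm w) * cis \<theta>"
    using Arg2pi_eq[of w] by (simp add: \<theta>_def cis_conv_exp)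
  define j where "j = \<lfloor>\<theta> / (2 * a)\<rfloor>"
  define s where "s = \<theta> - 2 * a * of_int j"
  have "of_int j \<le> \<theta> / (2 * a)" "\<theta> / (2 * a) < of_int j + 1"
    by (auto simp: j_def)
  then have s: "0 \<le> s" "s < 2 * a"
    using a_pos by (auto simp: s_def field_simps)
  show ?thesis
  proof (cases "s \<le> a")
    case True
    have "w = dih j False (of_real (norm w) * cis s)"
      by (subst w) (simp add: dih_def cis_mult s_def algebra_simps)
    moreover have "of_real (norm w) * cis s \<in> sector"
      using s True by (intro sector_polar_intro) auto
    ultimately show ?thesis using that by blast
  next
    case False
    \<comment> \<open>The upper half of a wedge of angle \<open>2 * a\<close> is folded back:
      conjugation followed by \<open>j + 1\<close> rotations sends the angle
      \<open>2 * a - s\<close> to \<open>2 * a * j + s\<close>.\<close>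
    have "w = dih (j + 1) True (of_real (norm w) * cis (2 * a - s))"
      by (subst w) (simp add: dih_def cis_cnj cis_mult s_def algebra_simps)
    moreover have "of_real (norm w) * cis (2 * a - s) \<in> sector"
      using s False by (intro sector_polar_intro) auto
    ultimately show ?thesis using that by blast
  qed
qed

lemma cis_eq_1_small:
  assumes "cis t = 1" "\<bar>t\<bar> < 2 * pi" shows "t = 0"
proof -
  have "cos t = 1" using assms(1) by (simp add: complex_eq_iff)
  then obtain i :: int where i: "t = of_int i * 2 * pi" by (auto simp: cos_one_2pi_int)
  then have "\<bar>of_int i\<bar> * (2 * pi) < 1 * (2 * pi)" using assms(2) by (simp add: abs_mult)
  then have "\<bar>of_int i :: real\<bar> < 1" by (subst (asm) mult_less_cancel_right) auto
  then have "i = 0" by linarith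
  then show ?thesis using i by simp
qed

text \<open>The \<open>n\<close>-th power of a rotation by a multiple of \<open>2 * a\<close> is the
  identity, so \<open>real n * t\<close> is a multiple of 2 pi, and it is smaller than 2 pi in
  modulus.\<close>

lemma cis_small_int:
  assumes "cis (2 * a * of_int j) = cis t" "- (2 * a) < t" "t < 2 * a"
  shows "t = 0 \<and> cis (2 * a * of_int j) = 1"
proof -
  have "cis (real n * t) = cis t ^ n" by (simp add: Complex.DeMoivre)
  also have "\<dots> = cis (2 * a * of_int j) ^ n" using assms by simp
  also have "\<dots> = cis (2 * pi * of_int j)" 
    unfolding Complex.DeMoivre by (simp add: ac_simps flip: na)
  finally have "cis (real n * t) = 1" by (simp add: cis_multiple_2pi)
  moreover have "\<bar>real n * t\<bar> < 2 * pi"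
  proof -
    have "real n * \<bar>t\<bar> < real n * (2 * a)" using assms n0 by (intro mult_strict_left_mono) auto
    then show ?thesis using na by (simp add: abs_mult algebra_simps)
  qed
  ultimately have "real n * t = 0" by (rule cis_eq_1_small)
  then show ?thesis using n0 assms by auto
qed

text \<open>The premises on \<open>u\<close> say that \<open>u\<close> lies on every edge of the sector that contains \<open>z\<close>.\<close>

lemma dih_fix:
  assumes "z \<in> sector" "z' \<in> sector" "z = dih j e z'"
  shows "z = z'"
    and "\<lbrakk>z = 0 \<Longrightarrow> u = 0; Im z = 0 \<Longrightarrow> Im u = 0; ht a z = 0 \<Longrightarrow> ht a u = 0\<rbrakk> \<Longrightarrow> dih j e u = u"
proof -
  obtain r s where rs: "z = of_real r * cis s" "norm z = r" "0 \<le> s" "s \<le> a"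
    using assms(1) by (rule sector_polar)
  obtain r' s' where rs': "z' = of_real r' * cis s'" "norm z' = r'" "0 \<le> s'" "s' \<le> a"
    using assms(2) by (rule sector_polar)
  have rr: "r = r'" using assms(3) rs(2) rs'(2) by (metis norm_dih)
  have "z = z' \<and> ((z = 0 \<longrightarrow> u = 0) \<and> (Im z = 0 \<longrightarrow> Im u = 0) \<and> (ht a z = 0 \<longrightarrow> ht a u = 0) \<longrightarrow> dih j e u = u)"
  proof (cases "r = 0")
    case True
    then show ?thesis using rs rs' rr by auto
  next
    case r0: False
    show ?thesis
    proof (cases e)
      case False
      have "cis s = cis (2 * a * of_int j) * cis s'"
        using assms(3) r0 False by (simp add: dih_def rs(1) rs'(1) rr)
      then have "cis s / cis s' = cis (2 * a * of_int j)" by simp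
      then have "cis (2 * a * of_int j) = cis (s - s')" by (simp only: cis_divide)
      from cis_small_int[OF this] rs rs' a_pos have "s = s'" "cis (2 * a * of_int j) = 1" by auto
      then show ?thesis using rs(1) rs'(1) rr False by (simp add: dih_def)
    next
      case True
      have "cis s = cis (2 * a * of_int j) * cis (- s')"
        using assms(3) r0 True by (simp add: dih_def rs(1) rs'(1) rr cis_cnj)
      then have "cis s / cis (- s') = cis (2 * a * of_int j)" by simp
      then have *: "cis (2 * a * of_int j) = cis (s + s')" by (simp only: cis_divide diff_minus_eq_add)
      \<comment> \<open>A reflection relates the angles through their sum, which can only be 0 or
        \<open>2 * a\<close>. So both points lie on the real edge or both on the inclined edge, and
        these edges are mirrors.\<close>
      show ?thesis
      proof (cases "s + s' < 2 * a")
        case less: True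
        then have "s + s' = 0" "cis (2 * a * of_int j) = 1" 
          using cis_small_int[OF *] rs rs' a_pos by auto
        then have "s = 0" "s' = 0" "cis (2 * a * of_int j) = 1" using rs rs' by auto
        then show ?thesis using rs(1) rs'(1) rr True by (auto simp: dih_def complex_eq_iff)
      next
        case False
        then have ss: "s = a" "s' = a" using rs rs' by auto
        then have z: "z = z'" "ht a z = 0" using rs(1) rs'(1) rr by (simp_all add: ht_rcis)
        have "dih j e u = u" if "ht a u = 0"
        proof -
          have "cis (2 * a * of_int j) = cis a * cis a"
            using * ss by (simp add: cis_mult)
          moreover have "u * cis (- a) = cnj (u * cis (- a))"
            using that by (simp add: ht_def complex_eq_iff)
          then have "cis a * cnj u = u * cis (-a)" by (simp add: cis_cnj mult.commute)
          ultimately have "dih j e u = cis a * (u * cis (- a))"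
            using True by (simp add: dih_def mult.assoc)
          also have "\<dots> = u * (cis a * cis (- a))" by (simp only: ac_simps)
          also have "\<dots> = u" unfolding cis_mult by simp
          finally show ?thesis .
        qed
        then show ?thesis using z by blast
      qed
    qed
  qed
  then show "z = z'" and "\<lbrakk>z = 0 \<Longrightarrow> u = 0; Im z = 0 \<Longrightarrow> Im u = 0; ht a z = 0 \<Longrightarrow> ht a u = 0\<rbrakk> \<Longrightarrow> dih j e u = u"
    by auto
qed

text \<open>The sector is a fundamental domain, and the symmetry by which a point is reached is
  determined up to the mirrors through its representative. This makes extension by symmetry well
  defined. Undoing one of the two symmetries reduces it to \<open>dih_fix\<close>.\<close>

lemma dih_eq:
  assumes "z \<in> sector" "z' \<in> sector" "dih i d z = dih j e z'"
  shows "z = z'"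
    and "\<lbrakk>z = 0 \<Longrightarrow> u = 0; Im z = 0 \<Longrightarrow> Im u = 0; ht a z = 0 \<Longrightarrow> ht a u = 0\<rbrakk> \<Longrightarrow> dih i d u = dih j e u"
proof -
  have *: "z = dinv i d (dih j e z')" using assms(3) by (metis dinv_dih)
  obtain l f where lf: "\<And>u. dinv i d (dih j e u) = dih l f u"
    by (simp add: dinv_def dih_dih)
  show "z = z'" using dih_fix(1)[OF assms(1,2)] * lf by metis
  assume "z = 0 \<Longrightarrow> u = 0" "Im z = 0 \<Longrightarrow> Im u = 0" "ht a z = 0 \<Longrightarrow> ht a u = 0"
  then have "dinv i d (dih j e u) = u" using dih_fix(2)[OF assms(1,2)] * lf by metis
  then show "dih i d u = dih j e u" by (metis dih_dinv)
qed

section \<open>The Schwarz--Christoffel integral on the closed sector\<close>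

text \<open>The factor \<open>\<i>\<close> turns \<open>1 - z ^ n\<close>, which lies in the closed lower half-plane for \<open>z\<close> in the
  sector, into the right half-plane, so that the principal power is continuous up to the edges.\<close>

definition vv :: "complex \<Rightarrow> complex" where
  "vv z = \<i> * (1 - z ^ n)"

text \<open>The constant undoes \<i> to the power -\<beta>, so this is the branch of (1 -
  z^n)^(-k/n) that is positive on [0, 1).\<close>

definition integrand :: "complex \<Rightarrow> complex" where
  "integrand z = cis (\<beta> * pi / 2) * vv z powr (- of_real \<beta>)"

text \<open>The argument of \<open>z ^ n\<close> is \<open>real n * s\<close>, which runs through
  [0, pi]: the half-sector opens up to the closed upper half-plane.\<close>

lemma sector_power:
  assumes "z \<in> sector"
  shows "0 \<le> Im (z ^ n)" and "z ^ n = 1 \<Longrightarrow> z = 1" and "z \<in> interior sector \<Longrightarrow> 0 < Im (z ^ n)"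
proof -
  obtain r s where rs: "z = of_real r * cis s" "norm z = r" "0 \<le> s" "s \<le> a"
    using assms by (rule sector_polar)
  have r0: "0 \<le> r" using rs(2) norm_ge_zero[of z] by linarith
  have zn: "z ^ n = of_real (r ^ n) * cis (real n * s)"
    unfolding rs(1) power_mult_distrib Complex.DeMoivre by simp
  have ns: "0 \<le> real n * s" "real n * s \<le> pi"
    using rs n0 mult_left_mono[OF rs(4), of "real n"] na by auto
  show "0 \<le> Im (z ^ n)" 
    unfolding zn using ns r0 by (simp add: sin_ge_zero)
  show "z = 1" if 1: "z ^ n = 1"
  proof -
    have "norm z ^ n = 1" using 1 by (metis norm_one norm_power)
    then have "r = 1" using rs(2) r0 n0 power_eq_imp_eq_base[of r n 1] by simp
    then have "cis (real n * s) = 1" using 1 zn by simp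
    then have "real n * s = 0" using ns pi_gt_zero by (intro cis_eq_1_small) linarith+
    then show ?thesis using n0 rs \<open>r = 1\<close> by simp
  qed
  show "0 < Im (z ^ n)" if "z \<in> interior sector"
  proof -
    have *: "0 < Im z" "ht a z < 0" using that by (auto simp: interior_sector)
    then have "r > 0" using rs r0 by (cases "r = 0") auto
    moreover have "s \<noteq> 0" using * rs(1) by auto
    moreover have "s \<noteq> a" using * rs(1) by (auto simp: ht_rcis)
    ultimately have "0 < real n * s" "real n * s < real n * a"
      using rs n0 by auto
    then show ?thesis unfolding zn using na \<open>r > 0\<close> by (simp add: sin_gt_zero)
  qed
qed

lemma Re_vv: "Re (vv z) = Im (z ^ n)"
  by (simp add: vv_def)

lemma vv_Re_nonneg: "z \<in> sector \<Longrightarrow> 0 \<le> Re (vv z)"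
  by (simp add: Re_vv sector_power)

lemma vv_eq_0: "z \<in> sector \<Longrightarrow> vv z = 0 \<longleftrightarrow> z = 1"
  using sector_power(2)[of z] by (auto simp: vv_def)

lemma norm_vv: "norm (vv z) = norm (1 - z ^ n)"
  by (simp add: vv_def norm_mult)

lemma vv_notin_nonpos: "\<lbrakk>z \<in> sector; z \<noteq> 1\<rbrakk> \<Longrightarrow> vv z \<notin> \<real>\<^sub>\<le>\<^sub>0"
  using vv_Re_nonneg[of z] vv_eq_0[of z] by (auto simp: complex_nonpos_Reals_iff complex_eq_iff)

lemma vv_deriv: "(vv has_field_derivative (- \<i> * of_nat n * z ^ (n - 1))) (at z within S)"
  unfolding vv_def by (auto intro!: derivative_eq_intros)

text \<open>A default value from the convention \<open>0 powr c = 0\<close>. It is a nonnegative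
  multiple of every direction, which suits the later sign arguments, and one point does not affect
  integrals.\<close>

lemma integrand_1 [simp]: "integrand 1 = 0"
  by (simp add: integrand_def vv_def)

text \<open>\<open>vv z\<close> lies in the closed right half-plane, so its argument
  \<open>t\<close> is at most pi/2 in modulus; the power and the constant turn it into
  \<open>\<beta> * (pi / 2 - t)\<close>, between 0 and \<open>\<beta> * pi\<close>.\<close>

lemma integrand_polar:
  assumes "z \<in> sector" "z \<noteq> 1"
  obtains \<theta> where "integrand z = of_real (norm (1 - z ^ n) powr (- \<beta>)) * cis \<theta>" "0 \<le> \<theta>" "\<theta> \<le> real k * a"
proof -
  have v: "vv z \<noteq> 0" "0 \<le> Re (vv z)" using assms vv_eq_0 vv_Re_nonneg by auto
  define t where "t = Im (Ln (vv z))"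
  have t: "\<bar>t\<bar> \<le> pi / 2" using v Re_Ln_pos_le[of "vv z"] by (simp add: t_def)
  have "vv z powr (- of_real \<beta>) = exp (of_real (- \<beta> * ln (norm (vv z))) + \<i> * of_real (- \<beta> * t))"
  proof -
    have "Ln (vv z) = of_real (ln (norm (vv z))) + \<i> * of_real t"
      using v by (simp add: complex_eq_iff t_def)
    then show ?thesis using v by (simp add: powr_def algebra_simps)
  qed
  also have "\<dots> = of_real (exp (- \<beta> * ln (norm (vv z)))) * cis (- \<beta> * t)"
    by (simp only: exp_add cis_conv_exp exp_of_real)
  also have "exp (- \<beta> * ln (norm (vv z))) = norm (1 - z ^ n) powr (- \<beta>)"
    using v by (simp add: powr_def flip: norm_vv)
  finally have "integrand z = of_real (norm (1 - z ^ n) powr (- \<beta>)) * cis (\<beta> * pi / 2 + (- \<beta> * t))"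
    by (simp only: integrand_def cis_mult[symmetric] ac_simps)
  moreover have "0 \<le> \<beta> * (pi / 2 - t)" "\<beta> * (pi / 2 - t) \<le> \<beta> * pi"
    using t beta_pos pi_gt_zero by (auto intro!: mult_left_mono mult_nonneg_nonneg)
  ultimately show ?thesis
    using that[of "\<beta> * pi / 2 + (- \<beta> * t)"] by (auto simp: ka algebra_simps)
qed

lemma norm_integrand: "\<lbrakk>z \<in> sector; z \<noteq> 1\<rbrakk> \<Longrightarrow> norm (integrand z) = norm (1 - z ^ n) powr (- \<beta>)"
  by (erule (1) integrand_polar) (simp add: norm_mult)

text \<open>Integrating by parts expresses the primitive through that of \<open>vv z powr (1 - \<beta>)\<close>,
  which is continuous at the branch point \<open>1\<close> as well.\<close>

lemma primitive_exists:
  "\<exists>G. G 0 = 0 \<and> continuous_on sector G \<and> (\<forall>z\<in>sector - {1}. (G has_field_derivative integrand z) (at z within sector))"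
proof -
  define q where "q z = vv z powr (1 - of_real \<beta>)" for z
  define m where "m = real n - real k"
  have m: "m > 0" "m = (1 - \<beta>) * real n" using kn n0 by (auto simp: m_def \<beta>_def field_simps)
  have contq: "continuous_on sector q"
    unfolding q_def
  proof (intro continuous_on_powr_complex)
    show "sector \<subseteq> {z. 0 \<le> Re (vv z) \<or> Im (vv z) \<noteq> 0}" using vv_Re_nonneg by auto
    show "continuous_on sector vv" unfolding vv_def by (intro continuous_intros)
  qed (use beta_lt in auto)
  \<comment> \<open>Continuity up to the edges and holomorphy inside suffice for a primitive on a
    convex set; the positive exponent \<open>1 - \<beta>\<close> gives continuity even at 1.\<close>
  obtain H where H: "\<And>z. z \<in> sector \<Longrightarrow> (H has_field_derivative q z) (at z within sector)"
  proof (rule holomorphic_convex_primitive[OF convex_sector, of "{}" q])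
    fix z assume z: "z \<in> interior sector - {}"
    then have "0 < Re (vv z)" using sector_power(3)[of z] interior_subset[of sector] by (auto simp: Re_vv)
    then have nn: "vv z \<notin> \<real>\<^sub>\<le>\<^sub>0" by (auto simp: complex_nonpos_Reals_iff)
    show "q field_differentiable at z"
      unfolding q_def field_differentiable_def
      by (rule exI, rule DERIV_chain2[OF has_field_derivative_powr[OF nn] vv_deriv])
  qed (use contq in auto)
  \<comment> \<open>With p = vv^(-\<beta>) and q = vv p, the relation vv = \<i> (1 - z^n) gives (z
    q)' = (1 + m) q - \<i> m p. Solving for p yields \<open>c\<close> and the formula for
    \<open>G\<close>.\<close>
  define c where "c = cis (\<beta> * pi / 2) / (\<i> * of_real m)"
  define G where "G z = c * (of_real (1 + m) * (H z - H 0) - z * q z)" for z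
  have "G 0 = 0" by (simp add: G_def)
  moreover have "continuous_on sector G"
    unfolding G_def by (intro continuous_intros contq DERIV_continuous_on[OF H])
  moreover have "(G has_field_derivative integrand z) (at z within sector)" if z: "z \<in> sector - {1}" for z
  proof -
    have nn: "vv z \<notin> \<real>\<^sub>\<le>\<^sub>0" and v0: "vv z \<noteq> 0" using z vv_notin_nonpos vv_eq_0 by auto
    define p where "p = vv z powr (- of_real \<beta>)"
    have "(1 - of_real \<beta> - 1 :: complex) = - of_real \<beta>" by simp
    then have "(q has_field_derivative ((1 - of_real \<beta>) * p * (- \<i> * of_nat n * z ^ (n - 1)))) (at z within sector)"
      unfolding q_def p_def using DERIV_chain2[OF has_field_derivative_powr[OF nn] vv_deriv, of "1 - of_real \<beta>"]
      by (metis (no_types, lifting))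
    then have "(G has_field_derivative c * (of_real (1 + m) * q z - (q z + z * ((1 - of_real \<beta>) * p * (- \<i> * of_nat n * z ^ (n - 1)))))) (at z within sector)"
      unfolding G_def using z by (auto intro!: derivative_eq_intros H)
    also have "c * (of_real (1 + m) * q z - (q z + z * ((1 - of_real \<beta>) * p * (- \<i> * of_nat n * z ^ (n - 1))))) = integrand z"
    proof -
      have qz: "q z = vv z * p"
        using powr_add[of "vv z" 1 "- of_real \<beta>"] v0 by (simp add: q_def p_def)
      have zn: "z * z ^ (n - 1) = z ^ n" using n2 by (simp flip: power_Suc)
      have "of_real (1 + m) * q z - (q z + z * ((1 - of_real \<beta>) * p * (- \<i> * of_nat n * z ^ (n - 1))))
         = of_real m * q z + \<i> * ((1 - of_real \<beta>) * of_nat n) * p * (z * z ^ (n - 1))"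
        by (simp add: algebra_simps)
      also have "(1 - of_real \<beta>) * of_nat n = (of_real m :: complex)"
        unfolding m(2) by simp
      also have "of_real m * q z + \<i> * of_real m * p * (z * z ^ (n - 1)) = \<i> * of_real m * p"
        unfolding zn qz vv_def by (simp add: algebra_simps)
      finally show ?thesis using m(1) by (simp add: c_def integrand_def p_def)
    qed
    finally show ?thesis .
  qed
  ultimately show ?thesis by blast
qed

definition G :: "complex \<Rightarrow> complex" where
  "G = (SOME G. G 0 = 0 \<and> continuous_on sector G \<and> (\<forall>z\<in>sector - {1}. (G has_field_derivative integrand z) (at z within sector)))"

lemma G_0 [simp]: "G 0 = 0" and G_cont: "continuous_on sector G"
  and G_deriv: "\<lbrakk>z \<in> sector; z \<noteq> 1\<rbrakk> \<Longrightarrow> (G has_field_derivative integrand z) (at z within sector)"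
  using someI_ex[OF primitive_exists] by (auto simp: G_def)

lemma finite_affine_eq:
  assumes "(d::complex) \<noteq> 0" shows "finite {t::real. z + of_real t * d = c}"
proof -
  have "t = Re ((c - z) / d)" if "z + of_real t * d = c" for t
    using that assms by (auto simp flip: that)
  then have "{t::real. z + of_real t * d = c} \<subseteq> {Re ((c - z) / d)}" by auto
  then show ?thesis using finite_subset by blast
qed

text \<open>At the branch point only continuity of \<open>G\<close> is available. A nonconstant
  affine path passes through it at most once, and a finite exceptional set is allowed.\<close>

lemma G_FTC:
  assumes "u \<le> v" "d \<noteq> 0" and inS: "\<And>t. t \<in> {u..v} \<Longrightarrow> z + of_real t * d \<in> sector"
  shows "((\<lambda>t. d * integrand (z + of_real t * d)) has_integral (G (z + of_real v * d) - G (z + of_real u * d))) {u..v}"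
proof (rule fundamental_theorem_of_calculus_interior_strong)
  define x where "x t = z + of_real t * d" for t :: real
  show "finite {t. x t = 1}" unfolding x_def using assms(2) by (rule finite_affine_eq)
  show "continuous_on {u..v} (\<lambda>t. G (z + of_real t * d))"
    using inS by (intro continuous_on_compose2[OF G_cont] continuous_intros) auto
  show "((\<lambda>t. G (z + of_real t * d)) has_vector_derivative d * integrand (z + of_real t * d)) (at t)"
    if t: "t \<in> {u<..<v} - {t. x t = 1}" for t
  proof -
    have "(x has_vector_derivative d) (at t within {u..v})"
      unfolding x_def by (auto intro!: derivative_eq_intros)
    moreover have "x ` {u..v} \<subseteq> sector" using inS by (auto simp: x_def)
    then have "(G has_field_derivative integrand (x t)) (at (x t) within x ` {u..v})"
      using t inS by (intro DERIV_subset[OF G_deriv]) (auto simp: x_def)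
    ultimately have "(G \<circ> x has_vector_derivative d * integrand (x t)) (at t within {u..v})"
      by (rule field_vector_diff_chain_within)
    moreover have "at t within {u..v} = at t" using t by (intro at_within_interior) auto
    ultimately show ?thesis by (simp add: x_def o_def)
  qed
qed (use assms in auto)

lemma sector_segment: "\<lbrakk>z \<in> sector; w \<in> sector; t \<in> {0..1}\<rbrakk> \<Longrightarrow> z + of_real t * (w - z) \<in> sector"
  using convexD_alt[OF convex_sector, of z w t] by (simp add: scaleR_conv_of_real algebra_simps)

lemma G_integral:
  assumes "z \<in> sector" "w \<in> sector"
  shows "((\<lambda>t. (w - z) * integrand (z + of_real t * (w - z))) has_integral (G w - G z)) {0..1}"
proof (cases "z = w")
  case False
  then show ?thesis using G_FTC[of 0 1 "w - z" z] sector_segment[OF assms] by simp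
qed simp

text \<open>Along a path of direction \<delta> the velocity of \<open>G\<close> has its argument
  between \<open>\<delta>\<close> and \<open>\<delta> + real k * a\<close>. If this range lies in
  [\<theta>, \<theta> + pi], the height above inclination \<theta> cannot decrease.\<close>

lemma G_ht_nonneg:
  assumes "z \<in> sector" "w \<in> sector" "w - z = of_real y * cis \<delta>" "0 \<le> y" "\<theta> \<le> \<delta>" "\<delta> + real k * a \<le> \<theta> + pi"
  shows "0 \<le> ht \<theta> (G w - G z)"
proof -
  have "((\<lambda>t. ht \<theta> ((w - z) * integrand (z + of_real t * (w - z)))) has_integral ht \<theta> (G w - G z)) {0..1}"
    unfolding ht_def by (intro has_integral_Im has_integral_mult_left G_integral assms)
  moreover have "0 \<le> ht \<theta> ((w - z) * integrand x)" if x: "x \<in> sector" for x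
  proof (cases "x = 1")
    case False
    obtain \<eta> where e: "integrand x = of_real (norm (1 - x ^ n) powr (- \<beta>)) * cis \<eta>" "0 \<le> \<eta>" "\<eta> \<le> real k * a"
      using integrand_polar[OF x False] .
    have "(w - z) * integrand x = of_real (y * norm (1 - x ^ n) powr (- \<beta>)) * cis (\<delta> + \<eta>)"
      unfolding assms(3) e(1) by (simp only: cis_mult[symmetric] of_real_mult ac_simps)
    then have "ht \<theta> ((w - z) * integrand x) = y * norm (1 - x ^ n) powr (- \<beta>) * sin (\<delta> + \<eta> - \<theta>)"
      by (simp only: ht_rcis)
    also have "\<dots> \<ge> 0" using assms e by (intro mult_nonneg_nonneg sin_ge_zero) auto
    finally show ?thesis .
  qed simp
  ultimately show ?thesis
    using sector_segment[OF assms(1,2)] by (auto elim!: has_integral_nonneg)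
qed

lemma G_ht_nonpos:
  assumes "z \<in> sector" "w \<in> sector" "w - z = of_real y * cis \<delta>" "0 \<le> y" "\<theta> \<le> \<delta> + pi" "\<delta> + real k * a \<le> \<theta>"
  shows "ht \<theta> (G w - G z) \<le> 0"
  using G_ht_nonneg[of z w y \<delta> "\<theta> - pi"] assms by (simp add: ht_eq)

lemma cos_half_beta_pos: "0 < cos (\<beta> * pi / 2)"
  using beta_pos beta_lt pi_gt_zero mult_strict_right_mono[OF beta_lt pi_gt_zero] 
  by (intro cos_gt_zero_pi) (auto simp: field_simps intro: less_trans[of _ 0])

text \<open>Lower bound, for points of the sector with norm at most \<open>R\<close>, of the
  component of the integrand along the direction bisecting its range of arguments: the angle to it
  is at most \<open>\<beta> * pi / 2\<close>, and |1 - z^n| is at most 1 + R^n.\<close>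

definition low :: "real \<Rightarrow> real" where
  "low R = cos (\<beta> * pi / 2) * (1 + R ^ n) powr (- \<beta>)"

lemma low_pos: "0 \<le> R \<Longrightarrow> 0 < low R"
  unfolding low_def using cos_half_beta_pos zero_le_power[of R n]
  by (intro mult_pos_pos) (auto simp del: zero_le_power simp: add_nonneg_eq_0_iff)

text \<open>All values of the integrand lie in a sector of angle less than \<open>\<pi>\<close>
  (Noshiro--Warschawski).\<close>

lemma G_lower:
  assumes "z \<in> sector" "w \<in> sector" "norm z \<le> R" "norm w \<le> R"
  shows "low R * norm (w - z) \<le> norm (G w - G z)"
proof (cases "z = w")
  case False
  define x where "x t = z + of_real t * (w - z)" for t :: real
  \<comment> \<open>Dividing by \<open>w - z\<close> removes the direction of the path, and the
    rotation centres the arguments of the integrand at 0.\<close>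
  define b where "b = cis (- (\<beta> * pi / 2)) / (w - z)"
  have R: "0 \<le> R" using assms(3) norm_ge_zero order_trans by blast
  have fin: "finite {t. x t = 1}" using False unfolding x_def by (intro finite_affine_eq) simp
  have I: "((\<lambda>t. Re (b * ((w - z) * integrand (x t)))) has_integral Re (b * (G w - G z))) {0..1}"
    unfolding x_def by (intro has_integral_Re has_integral_mult_right G_integral assms)
  have "low R \<le> Re (b * (G w - G z))"
  proof (rule has_integral_le)
    show "((\<lambda>t::real. low R) has_integral low R) {0..1}"
      using has_integral_const_real[of "low R" 0 1] by simp
    \<comment> \<open>The default value 0 at the branch point would violate the pointwise bound;
      changing the integrand on a finite set repairs this.\<close>
    show "((\<lambda>t. if x t = 1 then low R else Re (b * ((w - z) * integrand (x t)))) has_integral Re (b * (G w - G z))) {0..1}"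
      by (rule has_integral_spike_finite[OF fin _ I]) auto
    fix t :: real assume t: "t \<in> {0..1}"
    show "low R \<le> (if x t = 1 then low R else Re (b * ((w - z) * integrand (x t))))"
    proof (cases "x t = 1")
      case x1: False
      have xS: "x t \<in> sector" using sector_segment[OF assms(1,2) t] by (simp add: x_def)
      obtain \<eta> where e: "integrand (x t) = of_real (norm (1 - x t ^ n) powr (- \<beta>)) * cis \<eta>" "0 \<le> \<eta>" "\<eta> \<le> real k * a"
        using integrand_polar[OF xS x1] .
      have "norm (x t) \<le> R"
      proof -
        have "x t \<in> cball 0 R"
          using convexD_alt[OF convex_cball, of z 0 R w t] assms t 
          by (simp add: x_def scaleR_conv_of_real algebra_simps)
        then show ?thesis by simp
      qed
      then have "norm (x t ^ n) \<le> R ^ n" by (simp add: norm_power power_mono)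
      then have "norm (1 - x t ^ n) \<le> 1 + R ^ n"
        using norm_triangle_ineq4[of 1 "x t ^ n"] by simp
      moreover have "0 < norm (1 - x t ^ n)"
        using sector_power(2)[OF xS] x1 by auto
      ultimately have p: "(1 + R ^ n) powr (- \<beta>) \<le> norm (1 - x t ^ n) powr (- \<beta>)"
        using beta_pos by (intro powr_mono2') auto
      have "\<bar>\<eta> - \<beta> * pi / 2\<bar> \<le> \<beta> * pi / 2" using e(2,3) unfolding ka by linarith
      moreover have "\<beta> * pi \<le> 1 * pi" using beta_lt by (intro mult_right_mono) auto
      ultimately have "cos (\<beta> * pi / 2) \<le> cos \<bar>\<eta> - \<beta> * pi / 2\<bar>"
        using beta_pos pi_gt_zero by (intro cos_monotone_0_pi_le) auto
      then have c: "cos (\<beta> * pi / 2) \<le> cos (\<eta> - \<beta> * pi / 2)" by simp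
      have "b * ((w - z) * integrand (x t)) = of_real (norm (1 - x t ^ n) powr (- \<beta>)) * (cis (- (\<beta> * pi / 2)) * cis \<eta>)"
        using False unfolding b_def e(1) by simp
      then have "Re (b * ((w - z) * integrand (x t))) = norm (1 - x t ^ n) powr (- \<beta>) * cos (\<eta> - \<beta> * pi / 2)"
        by (simp add: cis_mult)
      also have "\<dots> \<ge> (1 + R ^ n) powr (- \<beta>) * cos (\<beta> * pi / 2)"
        using p c cos_half_beta_pos by (intro mult_mono) auto
      finally show ?thesis using x1 by (simp add: low_def mult.commute)
    qed auto
  qed
  also have "\<dots> \<le> norm (b * (G w - G z))" by (rule complex_Re_le_cmod)
  also have "\<dots> = norm (G w - G z) / norm (w - z)" by (simp add: b_def norm_mult norm_divide)
  finally show ?thesis using False by (simp add: field_simps)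
qed simp

lemma G_inj: "inj_on G sector"
proof (rule inj_onI)
  fix z w assume *: "z \<in> sector" "w \<in> sector" "G z = G w"
  define R where "R = max (norm z) (norm w)"
  have "low R * norm (w - z) \<le> 0" using G_lower[of z w R] * by (auto simp: R_def)
  moreover have "0 < low R" by (intro low_pos) (auto simp: R_def le_max_iff_disj)
  ultimately show "z = w" by (simp add: mult_le_0_iff)
qed

text \<open>An integrand of constant direction makes the image of a segment straight. The strict
  sign of \<open>s\<close> is taken from injectivity of \<open>G\<close>, so zeros of the integrand
  do no harm.\<close>

lemma G_segment:
  assumes "z \<in> sector" "w \<in> sector" "z \<noteq> w" "norm c = 1"
    and integrand: "\<And>t. t \<in> {0..1} \<Longrightarrow> \<exists>p\<ge>0. integrand (z + of_real t * (w - z)) = of_real p * c"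
  obtains s where "s > 0" "G w - G z = of_real s * ((w - z) * c)"
proof -
  define b where "b = 1 / ((w - z) * c)"
  have c0: "c \<noteq> 0" using assms(4) by auto
  define I where "I = b * (G w - G z)"
  have I: "((\<lambda>t. b * ((w - z) * integrand (z + of_real t * (w - z)))) has_integral I) {0..1}"
    unfolding I_def by (intro has_integral_mult_right G_integral assms)
  have *: "0 \<le> Re (b * ((w - z) * integrand (z + of_real t * (w - z)))) \<and> Im (b * ((w - z) * integrand (z + of_real t * (w - z)))) = 0"
    if t: "t \<in> {0..1}" for t
  proof -
    obtain p where p: "p \<ge> 0" "integrand (z + of_real t * (w - z)) = of_real p * c" using integrand[OF t] by blast
    have "b * ((w - z) * integrand (z + of_real t * (w - z))) = of_real p"
      unfolding p(2) b_def using c0 assms(3) by simp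
    then show ?thesis using p(1) by simp
  qed
  have "Re I \<ge> 0" using * by (intro has_integral_nonneg[OF has_integral_Re[OF I]]) auto
  moreover have "Im I = 0"
  proof -
    have "((\<lambda>t::real. 0) has_integral Im I) {0..1}"
      by (rule has_integral_eq[OF _ has_integral_Im[OF I]]) (use * in auto)
    then show ?thesis by (simp add: has_integral_0_eq)
  qed
  moreover have "I \<noteq> 0"
    using c0 assms(1-3) inj_onD[OF G_inj] by (auto simp: I_def b_def)
  ultimately have "Re I > 0" "I = of_real (Re I)" by (auto simp: complex_eq_iff)
  moreover have "G w - G z = I * ((w - z) * c)"
    using c0 assms(3) by (simp add: I_def b_def)
  ultimately show ?thesis using that by metis
qed

section \<open>Edges and range\<close>

lemma integrand_unit:
  assumes "0 \<le> x" "x \<le> 1"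
  shows "integrand (of_real x) = of_real ((1 - x ^ n) powr (- \<beta>))"
proof (cases "x = 1")
  case False
  define u where "u = 1 - x ^ n"
  have "x ^ n < 1" using assms False n0 by (simp add: power_less_one_iff)
  then have u: "0 < u" by (simp add: u_def)
  have vv: "vv (of_real x) = \<i> * of_real u" by (simp add: vv_def u_def)
  have "Ln (\<i> * of_real u) = of_real (ln u) + \<i> * of_real (pi / 2)"
    using u by (simp add: Ln_times_ii Ln_of_real)
  then have "(\<i> * of_real u) powr (- of_real \<beta>) = exp (of_real (- \<beta> * ln u) + \<i> * of_real (- (\<beta> * pi / 2)))"
    using u by (simp add: powr_def algebra_simps)
  also have "\<dots> = of_real (u powr (- \<beta>)) * cis (- (\<beta> * pi / 2))"
    using u by (simp only: exp_add cis_conv_exp exp_of_real powr_def) simp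
  finally show ?thesis by (simp add: integrand_def vv cis_mult mult.left_commute[of "cis _"] u_def)
qed (use n0 in auto)

text \<open>Beyond 1, \<open>vv\<close> has moved from the positive to the negative imaginary axis,
  so the argument of the integrand jumps from 0 to \<open>real k * a\<close>. This is the turn of
  the image boundary at A; the values are those on the upper side of the slit.\<close>

lemma integrand_slit:
  assumes "1 < x"
  shows "integrand (of_real x) = of_real ((x ^ n - 1) powr (- \<beta>)) * cis (real k * a)"
proof -
  define u where "u = x ^ n - 1"
  have "1 < x ^ n" using assms n0 by (simp add: one_less_power)
  then have u: "0 < u" by (simp add: u_def)
  have vv: "vv (of_real x) = of_real u * (- \<i>)" by (simp add: vv_def u_def algebra_simps)
  have "Ln (of_real u * (- \<i>)) = of_real (ln u) + \<i> * of_real (- (pi / 2))"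
    using u Ln_times_of_real[of u "- \<i>"] by (simp only: Ln_minus_ii) (simp add: Ln_of_real)
  then have "(of_real u * (- \<i>)) powr (- of_real \<beta>) = exp (of_real (- \<beta> * ln u) + \<i> * of_real (\<beta> * pi / 2))"
    using u unfolding powr_def by (simp only: ring_distribs of_real_mult of_real_minus) (simp add: ac_simps)
  also have "\<dots> = of_real (u powr (- \<beta>)) * cis (\<beta> * pi / 2)"
    using u by (simp only: exp_add cis_conv_exp exp_of_real powr_def) simp
  finally show ?thesis by (simp add: integrand_def vv cis_mult mult.left_commute[of "cis _"] u_def ka mult.commute[of \<beta> pi])
qed

lemma cis_a_power: "cis a ^ n = -1"
  unfolding Complex.DeMoivre na by simp

lemma integrand_ray:
  assumes "0 \<le> x"
  shows "integrand (of_real x * cis a) = of_real ((1 + x ^ n) powr (- \<beta>))"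
proof -
  define u where "u = 1 + x ^ n"
  have u: "0 < u" unfolding u_def using zero_le_power[OF assms, of n] by linarith
  have vv: "vv (of_real x * cis a) = \<i> * of_real u" 
    by (simp add: vv_def u_def power_mult_distrib cis_a_power)
  have "Ln (\<i> * of_real u) = of_real (ln u) + \<i> * of_real (pi / 2)"
    using u by (simp add: Ln_times_ii Ln_of_real)
  then have "(\<i> * of_real u) powr (- of_real \<beta>) = exp (of_real (- \<beta> * ln u) + \<i> * of_real (- (\<beta> * pi / 2)))"
    using u by (simp add: powr_def algebra_simps)
  also have "\<dots> = of_real (u powr (- \<beta>)) * cis (- (\<beta> * pi / 2))"
    using u by (simp only: exp_add cis_conv_exp exp_of_real powr_def) simp
  finally show ?thesis by (simp add: integrand_def vv cis_mult mult.left_commute[of "cis _"] u_def)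
qed

lemma G_unit_step:
  assumes "0 \<le> x" "x < y" "y \<le> 1"
  obtains s where "s > 0" "G (of_real y) = G (of_real x) + of_real s"
proof -
  have "\<exists>s>0. G (of_real y) - G (of_real x) = of_real s * ((of_real y - of_real x) * 1)"
  proof (rule G_segment[of "of_real x" "of_real y" 1])
    fix t :: real assume t: "t \<in> {0..1}"
    have "0 \<le> x + t * (y - x)" "x + t * (y - x) \<le> 1" 
      using assms t mult_left_le_one_le[of "y - x" t] mult_nonneg_nonneg[of t "y - x"]
      by (simp, simp, linarith)
    from integrand_unit[OF this]
    show "\<exists>p\<ge>0. integrand (of_real x + of_real t * (of_real y - of_real x)) = of_real p * 1"
      by (intro exI[of _ "(1 - (x + t * (y - x)) ^ n) powr (- \<beta>)"]) simp
  qed (use assms in auto)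
  then obtain s where s: "s > 0" "G (of_real y) - G (of_real x) = of_real (s * (y - x))" by auto
  show ?thesis using s assms that[of "s * (y - x)"] by (simp add: algebra_simps)
qed

lemma G_slit_step:
  assumes "1 \<le> x" "x < y"
  obtains s where "s > 0" "G (of_real y) = G (of_real x) + of_real s * cis (real k * a)"
proof -
  have "\<exists>s>0. G (of_real y) - G (of_real x) = of_real s * ((of_real y - of_real x) * cis (real k * a))"
  proof (rule G_segment[of "of_real x" "of_real y" "cis (real k * a)"])
    fix t :: real assume t: "t \<in> {0..1}"
    have *: "1 \<le> x + t * (y - x)" using assms t by (auto intro: order_trans[of 1 x])
    show "\<exists>p\<ge>0. integrand (of_real x + of_real t * (of_real y - of_real x)) = of_real p * cis (real k * a)"
    proof (cases "x + t * (y - x) = 1")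
      case True
      then have "of_real x + of_real t * (of_real y - of_real x) = (1::complex)"
        by (metis of_real_1 of_real_add of_real_diff of_real_mult)
      then show ?thesis by (intro exI[of _ 0]) simp
    next
      case False
      then have "1 < x + t * (y - x)" using * by simp
      from integrand_slit[OF this] show ?thesis
        by (intro exI[of _ "((x + t * (y - x)) ^ n - 1) powr (- \<beta>)"]) simp
    qed
  qed (use assms in auto)
  then obtain s where s: "s > 0" "G (of_real y) - G (of_real x) = of_real s * ((of_real y - of_real x) * cis (real k * a))" by auto
  show ?thesis using s assms that[of "s * (y - x)"] by (simp add: algebra_simps)
qed

lemma G_ray_step:
  assumes "0 \<le> x" "x < y"
  obtains s where "s > 0" "G (of_real y * cis a) = G (of_real x * cis a) + of_real s * cis a"
proof -
  have "\<exists>s>0. G (of_real y * cis a) - G (of_real x * cis a) = of_real s * ((of_real y * cis a - of_real x * cis a) * 1)"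
  proof (rule G_segment[of "of_real x * cis a" "of_real y * cis a" 1])
    fix t :: real assume t: "t \<in> {0..1}"
    have *: "0 \<le> x + t * (y - x)" using assms t by auto
    have e: "of_real x * cis a + of_real t * (of_real y * cis a - of_real x * cis a) = of_real (x + t * (y - x)) * cis a"
      by (simp add: algebra_simps)
    show "\<exists>p\<ge>0. integrand (of_real x * cis a + of_real t * (of_real y * cis a - of_real x * cis a)) = of_real p * 1"
      unfolding e integrand_ray[OF *]
      by (intro exI[of _ "(1 + (x + t * (y - x)) ^ n) powr (- \<beta>)"]) simp
  qed (use assms sector_cis_a in auto)
  then obtain s where s: "s > 0" "G (of_real y * cis a) - G (of_real x * cis a) = of_real s * ((of_real y * cis a - of_real x * cis a) * 1)" by auto
  show ?thesis using s assms that[of "s * (y - x)"] by (simp add: algebra_simps)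
qed

text \<open>Continuity of the primitive at 1 makes the improper integral exist up to the endpoint,
  so \<open>phi n k\<close> is a genuine integral rather than a default value.\<close>

lemma G_unit_F_int:
  assumes "0 \<le> x" "x \<le> 1"
  shows "G (of_real x) = of_real (F_int n k x)"
proof -
  have "((\<lambda>t. 1 * integrand (0 + of_real t * 1)) has_integral (G (0 + of_real x * 1) - G (0 + of_real 0 * 1))) {0..x}"
    by (rule G_FTC) (use assms in auto)
  then have "((\<lambda>t. integrand (of_real t)) has_integral G (of_real x)) {0..x}" by simp
  then have I: "((\<lambda>t. of_real ((1 - t ^ n) powr (- \<beta>)) :: complex) has_integral G (of_real x)) {0..x}"
    by (rule has_integral_eq[rotated]) (use assms integrand_unit in auto)
  have "((\<lambda>t. (1 - t ^ n) powr (- \<beta>)) has_integral Re (G (of_real x))) {0..x}"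
    using has_integral_Re[OF I] by simp
  then have "F_int n k x = Re (G (of_real x))"
    by (simp add: F_int_def \<beta>_def integral_unique)
  moreover have "((\<lambda>t::real. 0) has_integral Im (G (of_real x))) {0..x}"
    using has_integral_Im[OF I] by simp
  then have "Im (G (of_real x)) = 0" using has_integral_unique has_integral_0 by blast
  ultimately show ?thesis by (simp add: complex_eq_iff)
qed

lemma G_1: "G 1 = of_real (phi n k)"
  using G_unit_F_int[of 1] by (simp add: phi_def)

lemma phi_pos: "0 < phi n k"
proof -
  obtain s where "s > 0" "G (of_real 1) = G (of_real 0) + of_real s"
    using G_unit_step[of 0 1] by auto
  then show ?thesis using G_1 by simp
qed

lemma G_unit_less:
  assumes "0 \<le> x" "x < 1"
  obtains y where "0 \<le> y" "y < phi n k" "G (of_real x) = of_real y" "x > 0 \<Longrightarrow> y > 0"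
proof -
  obtain s where s: "s > 0" "G (of_real 1) = G (of_real x) + of_real s"
    using G_unit_step[of x 1] assms by auto
  have "0 \<le> F_int n k x \<and> (x > 0 \<longrightarrow> F_int n k x > 0)"
  proof (cases "x = 0")
    case True
    then show ?thesis by (simp add: F_int_def)
  next
    case False
    then obtain s where "s > 0" "G (of_real x) = G (of_real 0) + of_real s"
      using G_unit_step[of 0 x] assms by auto
    then show ?thesis using G_unit_F_int[of x] assms by simp
  qed
  moreover have "phi n k = F_int n k x + s"
    using s G_unit_F_int[of x] G_1 assms by (simp flip: of_real_add)
  ultimately show ?thesis using that[of "F_int n k x"] s G_unit_F_int[of x] assms by auto
qed

lemma G_slit:
  assumes "1 \<le> x"
  obtains s where "0 \<le> s" "x > 1 \<Longrightarrow> 0 < s" "G (of_real x) = of_real (phi n k) + of_real s * cis (real k * a)"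
proof (cases "x = 1")
  case True
  then show ?thesis using that[of 0] G_1 by simp
next
  case False
  then obtain s where "s > 0" "G (of_real x) = G (of_real 1) + of_real s * cis (real k * a)"
    using G_slit_step[of 1 x] assms by auto
  then show ?thesis using that[of s] G_1 by simp
qed

lemma G_ray:
  assumes "0 \<le> x"
  obtains s where "0 \<le> s" "x > 0 \<Longrightarrow> 0 < s" "G (of_real x * cis a) = of_real s * cis a"
proof (cases "x = 0")
  case True
  then show ?thesis using that[of 0] by simp
next
  case False
  then obtain s where "s > 0" "G (of_real x * cis a) = G (of_real 0 * cis a) + of_real s * cis a"
    using G_ray_step[of 0 x] assms by auto
  then show ?thesis using that[of s] by simp
qed

section \<open>The image region of the half-sector\<close>

text \<open>The bounding lines are OA, the bisector, and the outer line through A: they form a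
  triangle for \<open>k > 1\<close>. For \<open>k = 1\<close> the last two are parallel and the
  region is a half-strip.\<close>

definition piece :: "complex set" where
  "piece = {w. 0 \<le> Im w \<and> ht a w \<le> 0 \<and> 0 \<le> ht (real k * a) (w - of_real (phi n k))}"

lemma piece_subset_sector: "piece \<subseteq> sector"
  by (auto simp: piece_def sector_def)

lemma piece_eq: "piece = sector \<inter> {w. - (phi n k * sin (real k * a)) \<le> ht (real k * a) w}"
  by (auto simp: piece_def sector_def ht_diff)

lemma closed_piece: "closed piece"
  unfolding piece_eq by (intro closed_Int closed_sector closed_Collect_le continuous_intros)

lemma convex_piece: "convex piece"
  unfolding piece_eq ht_inner by (intro convex_Int convex_sector convex_halfspace_ge)

lemma ht_slit_nonneg: assumes "0 \<le> x" shows "0 \<le> ht (real k * a) (G (of_real x) - of_real (phi n k))"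
proof (cases "x < 1")
  case True
  obtain y where y: "y < phi n k" "G (of_real x) = of_real y" using G_unit_less assms True by metis
  have "ht (real k * a) (G (of_real x) - of_real (phi n k)) = (phi n k - y) * sin (real k * a)"
    unfolding y(2) ht_diff by (simp add: algebra_simps)
  then show ?thesis using y sin_ka_pos by simp
next
  case False
  then obtain s where "G (of_real x) = of_real (phi n k) + of_real s * cis (real k * a)"
    using G_slit[of x] by auto
  then show ?thesis by (simp add: ht_rcis)
qed

text \<open>Each half-plane bound on \<open>G z\<close> results from integrating from a boundary
  point along a direction that keeps the integrand in the half-plane.\<close>

lemma G_in_piece: assumes z: "z \<in> sector" shows "G z \<in> piece"
proof -
  obtain r s where rs: "z = of_real r * cis s" "norm z = r" "0 \<le> s" "s \<le> a"
    using z by (rule sector_polar)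
  have r0: "0 \<le> r" using rs(2) norm_ge_zero[of z] by linarith
  have "0 \<le> ht 0 (G z - G 0)"
    by (rule G_ht_nonneg[of 0 z r s]) (use z rs ka1 r0 in auto)
  moreover have "ht a (G z) \<le> 0"
  proof -
    \<comment> \<open>In this direction the velocities have arguments in [a - k a, a], hence point
      to the lower side of the bisector. Splitting \<open>z\<close> by the law of sines along
      \<open>cis a\<close> and \<open>cis \<delta>\<close> gives a starting point on the inclined
      edge, whose image is on the bisector.\<close>
    define \<delta> where "\<delta> = a - real k * a"
    define y where "y = r * sin (a - s) / sin (real k * a)"
    define x where "x = r * sin (s - \<delta>) / sin (real k * a)"
    have xy: "0 \<le> x" "0 \<le> y"
      unfolding x_def y_def \<delta>_def using r0 rs sin_ka_pos a_lt_pi2 ka1 a_le_ka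
      by (auto intro!: divide_nonneg_pos mult_nonneg_nonneg sin_ge_zero)
    have "cis s * of_real (sin (real k * a)) = of_real (sin (s - \<delta>)) * cis a + of_real (sin (a - s)) * cis \<delta>"
    proof -
      have *: "sin (a - \<delta>) * sin s = sin (s - \<delta>) * sin a + sin (a - s) * sin \<delta>"
        "sin (a - \<delta>) * cos s = sin (s - \<delta>) * cos a + sin (a - s) * cos \<delta>"
        by (simp_all add: sin_diff algebra_simps)
      show ?thesis using * by (simp add: complex_eq_iff \<delta>_def mult.commute)
    qed
    note id = this
    have "z = of_real r * (cis s * of_real (sin (real k * a))) / of_real (sin (real k * a))"
      using sin_ka_pos rs(1) by simp
    also have "\<dots> = of_real x * cis a + of_real y * cis \<delta>"
      unfolding id by (simp add: x_def y_def distrib_left add_divide_distrib mult.assoc)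
    finally have zz: "z = of_real x * cis a + of_real y * cis \<delta>" .
    have "ht a (G z - G (of_real x * cis a)) \<le> 0"
      by (rule G_ht_nonpos[of "of_real x * cis a" z y \<delta>])
        (use xy z zz ka1 sector_cis_a a_pos ka_lt in \<open>auto simp: \<delta>_def\<close>)
    moreover obtain l where "G (of_real x * cis a) = of_real l * cis a"
      using G_ray[OF xy(1)] by metis
    then have "ht a (G (of_real x * cis a)) = 0" by (simp add: ht_rcis)
    ultimately show ?thesis by (simp add: ht_diff)
  qed
  moreover have "0 \<le> ht (real k * a) (G z - of_real (phi n k))"
  proof -
    \<comment> \<open>Now the start is on the real edge and the direction is
      \<open>real k * a\<close>, so the velocities, with arguments in [k a, 2 k a], do not lower the
      height above the outer line.\<close>
    define y where "y = r * sin s / sin (real k * a)"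
    define x where "x = r * sin (real k * a - s) / sin (real k * a)"
    have xy: "0 \<le> x" "0 \<le> y"
      unfolding x_def y_def using r0 rs sin_ka_pos a_lt_pi2 ka_lt a_le_ka
      by (auto intro!: divide_nonneg_pos mult_nonneg_nonneg sin_ge_zero)
    have "cis s * of_real (sin (real k * a)) = of_real (sin (real k * a - s)) + of_real (sin s) * cis (real k * a)"
      by (simp add: complex_eq_iff sin_diff algebra_simps)
    note id = this
    have "z = of_real r * (cis s * of_real (sin (real k * a))) / of_real (sin (real k * a))"
      using sin_ka_pos rs(1) by simp
    also have "\<dots> = of_real x + of_real y * cis (real k * a)"
      unfolding id by (simp add: x_def y_def distrib_left add_divide_distrib mult.assoc)
    finally have zz: "z = of_real x + of_real y * cis (real k * a)" .
    have "0 \<le> ht (real k * a) (G z - G (of_real x))"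
      by (rule G_ht_nonneg[of "of_real x" z y "real k * a"]) (use xy z zz ka_lt in auto)
    then show ?thesis using ht_slit_nonneg[OF xy(1)] by (simp add: ht_diff)
  qed
  ultimately show ?thesis by (simp add: piece_def Im_eq_ht)
qed

lemma interior_piece: "w \<in> interior piece \<Longrightarrow> 0 < Im w \<and> ht a w < 0 \<and> 0 < ht (real k * a) (w - of_real (phi n k))"
  using ht_pos_interior[of piece 0 0] ht_neg_interior[of piece a 0]
    ht_pos_interior[of piece "- (phi n k * sin (real k * a))" "real k * a"]
  by (force simp: piece_def Im_eq_ht ht_diff)

lemma G_open_interior: "open (G ` interior sector)"
proof -
  have "G holomorphic_on interior sector"
  proof (rule holomorphic_onI)
    fix z assume z: "z \<in> interior sector"
    then have "z \<noteq> 1" by (auto simp: interior_sector)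
    then have "(G has_field_derivative integrand z) (at z within interior sector)"
      using z interior_subset by (intro DERIV_subset[OF G_deriv]) auto
    then show "G field_differentiable at z within interior sector"
      by (auto simp: field_differentiable_def)
  qed
  moreover have "inj_on G (interior sector)" using G_inj interior_subset inj_on_subset by blast
  ultimately show ?thesis by (intro open_mapping_thm3) auto
qed

lemma G_interior: "G ` interior sector \<subseteq> interior piece"
  using G_open_interior G_in_piece interior_subset by (intro interior_maximal) auto

text \<open>For \<open>k > 1\<close> strictness comes from a later slit point: from \<open>x\<close>
  to \<open>x + 1\<close> the height above the bisector grows by a positive amount and is still
  nonpositive at the end. For \<open>k = 1\<close> the edge is parallel to the bisector.\<close>

lemma G_slit_ht: assumes "1 \<le> x" shows "ht a (G (of_real x)) < 0"
proof -
  obtain s where s: "0 < s" "G (of_real (x + 1)) = G (of_real x) + of_real s * cis (real k * a)"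
    using G_slit_step[of x "x + 1"] assms by auto
  have *: "0 \<le> x + 1" using assms by simp
  have "ht a (G (of_real (x + 1))) \<le> 0" using G_in_piece[of "of_real (x + 1)"] * 
    unfolding sector_of_real by (simp add: piece_def)
  then have le: "ht a (G (of_real x)) + s * sin (real k * a - a) \<le> 0"
    unfolding s(2) ht_add ht_rcis .
  show ?thesis
  proof (cases "k = 1")
    case True
    obtain s where "G (of_real x) = of_real (phi n k) + of_real s * cis (real k * a)"
      using G_slit[OF assms] by metis
    then have "ht a (G (of_real x)) = - (phi n k * sin a)"
      using True by (simp add: ht_add ht_rcis)
    then show ?thesis using phi_pos sin_a_pos by simp
  next
    case False
    then have "0 < s * sin (real k * a - a)" using k1 s sin_k1a_pos by simp
    then show ?thesis using le by linarith
  qed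
qed

lemma G_slit_Im: assumes "1 < x" shows "0 < Im (G (of_real x))"
proof -
  obtain s where "0 < s" "G (of_real x) = of_real (phi n k) + of_real s * cis (real k * a)"
    using G_slit[of x] assms by (metis less_imp_le)
  then show ?thesis using sin_ka_pos by simp
qed

text \<open>With \<open>G_ht_zero\<close>: if \<open>G z\<close> is on a mirror, so is
  \<open>z\<close>. This is the condition under which \<open>dih_eq\<close> carries an equality of
  symmetries from \<open>G z\<close> back to \<open>z\<close>.\<close>

lemma G_Im_zero: assumes "z \<in> sector" "Im (G z) = 0" shows "Im z = 0" "z \<notin> of_real ` {1<..}"
proof -
  show "z \<notin> of_real ` {1<..}" using assms G_slit_Im by force
  show "Im z = 0" using assms(1)
  proof (cases rule: sector_cases)
    case 1
    then show ?thesis using assms interior_piece G_interior by force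
  next
    case (3 x)
    obtain s where s: "x > 0 \<Longrightarrow> s > 0" "G z = of_real s * cis a" using G_ray[OF 3(2)] 3(1) by metis
    then show ?thesis using 3 assms(2) sin_a_pos by (cases "x = 0") auto
  qed auto
qed

lemma G_ht_zero: assumes "z \<in> sector" "ht a (G z) = 0" shows "ht a z = 0"
  using assms(1)
proof (cases rule: sector_cases)
  case 1
  then show ?thesis using assms interior_piece G_interior by force
next
  case (2 x)
  show ?thesis
  proof (cases "x < 1")
    case True
    obtain y where y: "G z = of_real y" "x > 0 \<Longrightarrow> y > 0" using G_unit_less[OF 2(2) True] 2(1) by metis
    then show ?thesis using 2 assms(2) sin_a_pos by (cases "x = 0") auto
  next
    case False
    then show ?thesis using G_slit_ht[of x] 2 assms(2) by simp
  qed
qed (simp add: ht_rcis)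

end

section \<open>Behaviour at infinity and the inverse on one piece\<close>

lemma ht_le_norm: "\<bar>ht \<theta> w\<bar> \<le> norm w"
  using abs_Im_le_cmod[of "w * cis (- \<theta>)"] by (simp add: ht_def norm_mult)

lemma one_plus_power_le:
  assumes "0 \<le> (t::real)" "1 \<le> m" shows "1 + t ^ m \<le> (1 + t) ^ m"
  using assms(2)
proof (induction m rule: dec_induct)
  case (step m)
  have "1 + t ^ Suc m \<le> (1 + t) * (1 + t ^ m)"
    using assms(1) by (simp add: algebra_simps)
  also have "\<dots> \<le> (1 + t) * (1 + t) ^ m"
    using step assms by (intro mult_left_mono) auto
  finally show ?case by simp
qed simp

context sc_map
begin

lemma norm_integrand_le:
  assumes "z \<in> sector" "2 \<le> norm z"
  shows "norm (integrand z) \<le> 2 / norm z ^ k"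
proof -
  define r where "r = norm z"
  have r: "2 \<le> r" "0 < r" using assms by (auto simp: r_def)
  have "2 \<le> r ^ n" using r self_le_power[of r n] n2 by simp
  have "r ^ n / 2 \<le> norm (z ^ n) - norm (1::complex)" 
    using \<open>2 \<le> r ^ n\<close> by (simp add: norm_power r_def field_simps)
  also have "\<dots> \<le> norm (1 - z ^ n)" by (metis norm_minus_commute norm_triangle_ineq2)
  finally have "norm (1 - z ^ n) powr (- \<beta>) \<le> (r ^ n / 2) powr (- \<beta>)"
    using \<open>2 \<le> r ^ n\<close> beta_pos by (intro powr_mono2') auto
  also have "\<dots> = r powr (- (real n * \<beta>)) * 2 powr \<beta>"
    using r by (simp add: powr_divide powr_powr powr_minus divide_simps flip: powr_realpow)
  also have "real n * \<beta> = real k" using n0 by (simp add: \<beta>_def)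
  also have "r powr (- real k) * 2 powr \<beta> \<le> r powr (- real k) * 2 powr 1"
    using beta_lt by (intro mult_left_mono powr_mono) auto
  also have "\<dots> = 2 / r ^ k" using r by (simp add: powr_minus powr_realpow divide_simps)
  finally show ?thesis using norm_integrand[OF assms(1)] assms by (cases "z = 1") (auto simp: r_def)
qed

text \<open>The path is the chord, along which the modulus is at least \<open>R / 2\<close>;
  \<open>4 \<le> R\<close> then makes \<open>norm_integrand_le\<close> applicable. The bound is the
  constant 8 for \<open>k = 1\<close> and at most 16/R for \<open>k > 1\<close>.\<close>

lemma G_arc:
  assumes z: "z \<in> sector" and R: "norm z = R" "4 \<le> R"
  shows "norm (G z - G (of_real R * cis a)) \<le> 2 / (R / 2) ^ k * (2 * R)"
proof -
  define w where "w = of_real R * cis a"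
  \<comment> \<open>\<open>ht \<theta>\<close> is the component along the bisector of the sector.
    Angles to it are at most pi/3, so it is at least half of the modulus, and its linearity carries
    the bound over to chords.\<close>
  define \<theta> where "\<theta> = a / 2 - pi / 2"
  have half: "1 / 2 * norm u \<le> ht \<theta> u" if u: "u \<in> sector" for u
  proof -
    obtain r s where rs: "u = of_real r * cis s" "norm u = r" "0 \<le> s" "s \<le> a"
      using u by (rule sector_polar)
    have "\<bar>s - a / 2\<bar> \<le> pi / 3" using rs a_le a_pos by linarith
    then have "cos (pi / 3) \<le> cos \<bar>s - a / 2\<bar>"
      using pi_gt_zero by (intro cos_monotone_0_pi_le) auto
    then have "1 / 2 \<le> cos (s - a / 2)" by (simp add: cos_60)
    also have "cos (s - a / 2) = sin (s - \<theta>)"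
      using sin_cos_eq[of "s - \<theta>"] cos_minus[of "s - a / 2"] by (simp add: \<theta>_def algebra_simps)
    finally have "norm u * (1 / 2) \<le> norm u * sin (s - \<theta>)" by (rule mult_left_mono) simp
    moreover have "ht \<theta> u = norm u * sin (s - \<theta>)"
      using rs(2) by (subst rs(1)) (simp add: ht_rcis)
    ultimately show ?thesis by simp
  qed
  have w: "w \<in> sector" "norm w = R" using R by (auto simp: w_def sector_cis_a norm_mult)
  have "norm (integrand x) \<le> 2 / (R / 2) ^ k" if t: "t \<in> {0..1}" and x: "x = w + of_real t * (z - w)" for t x
  proof -
    have xS: "x \<in> sector" unfolding x by (intro sector_segment w z t)
    have "R / 2 = (1 - t) * (R / 2) + t * (R / 2)" by (simp add: field_simps)
    also have "\<dots> \<le> (1 - t) * ht \<theta> w + t * ht \<theta> z"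
      using t half[OF w(1)] half[OF z] w R by (intro add_mono mult_left_mono) auto
    also have "\<dots> = ht \<theta> x" unfolding x ht_add ht_of_real_mult ht_diff by (simp add: algebra_simps)
    also have "\<dots> \<le> norm x" using ht_le_norm[of \<theta> x] by linarith
    finally have le: "R / 2 \<le> norm x" .
    then have "norm (integrand x) \<le> 2 / norm x ^ k" using R xS by (intro norm_integrand_le) auto
    also have "\<dots> \<le> 2 / (R / 2) ^ k" 
      using R le by (intro divide_left_mono power_mono mult_pos_pos zero_less_power) linarith+
    finally show ?thesis .
  qed
  moreover have zw: "norm (z - w) \<le> 2 * R" using norm_triangle_ineq4[of z w] w R by simp
  ultimately have "norm ((z - w) * integrand (w + of_real t * (z - w))) \<le> 2 / (R / 2) ^ k * (2 * R)"
    if "t \<in> {0..1}" for t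
    unfolding norm_mult mult.commute[of "norm (z - w)"] using that R by (intro mult_mono) auto
  then have "norm (G z - G w) \<le> 2 / (R / 2) ^ k * (2 * R) * measure lborel (cbox 0 (1::real))"
    using R by (intro has_integral_bound[OF _ G_integral[OF w(1) z, unfolded box_real[symmetric]]]) auto
  then show ?thesis by (simp add: w_def)
qed

text \<open>Length of AP by the law of sines in the triangle OAP, with angles \<open>a\<close> at O
  and \<open>real k * a - a\<close> at P.\<close>

definition L :: real where "L = phi n k * sin a / sin (real k * a - a)"

lemma pt_P_eq: assumes "k > 1" shows "pt_P n k = of_real (phi n k) + of_real L * cis (real k * a)"
proof -
  have e: "pi / real n = a" "(real k - 1) * pi / real n = real k * a - a" "real k * pi / real n = real k * a"
    using n0 by (auto simp: a_def field_simps)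
  show ?thesis using pt_P_minus_pt_A[OF assms kn] unfolding e pt_A_def L_def[symmetric]
    by (simp add: algebra_simps)
qed

lemma ht_pt_P: assumes "k > 1" shows "ht a (pt_P n k) = 0"
  unfolding pt_P_eq[OF assms] ht_add ht_rcis using sin_k1a_pos[OF assms] by (simp add: L_def)

lemma G_ray_on: "0 \<le> x \<Longrightarrow> ht a (G (of_real x * cis a)) = 0"
  by (erule G_ray) (simp add: ht_rcis)

text \<open>The images of \<open>R\<close> and \<open>R * cis a\<close> lie on the outer line and on
  the bisector, within 16/R of each other. These lines cross at P under a positive angle, so the
  first image must be close to P.\<close>

lemma G_at_infinity:
  assumes "k > 1"
  obtains K where "K > 0" "\<And>z. z \<in> sector \<Longrightarrow> 4 \<le> norm z \<Longrightarrow> norm (G z - pt_P n k) \<le> K / norm z"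
proof -
  define S where "S = sin (real k * a - a)"
  have S: "0 < S" using sin_k1a_pos[OF assms] by (simp add: S_def)
  have arc: "norm (G z - G (of_real R * cis a)) \<le> 16 / R" if "z \<in> sector" "norm z = R" "4 \<le> R" for z R
  proof -
    have "norm (G z - G (of_real R * cis a)) \<le> 2 / (R / 2) ^ k * (2 * R)" by (rule G_arc) fact+
    also have "\<dots> \<le> 2 / (R / 2) ^ 2 * (2 * R)"
      using that assms by (intro mult_right_mono divide_left_mono power_increasing) auto
    also have "\<dots> = 16 / R" using that by (simp add: power2_eq_square)
    finally show ?thesis .
  qed
  \<comment> \<open>Two chord estimates contribute 32; the distance from P along the outer line
    contributes \<open>16 / S\<close>.\<close>
  show ?thesis
  proof (rule that[of "32 + 16 / S"])
    show "32 + 16 / S > 0" using S by (intro add_pos_pos) auto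
    fix z assume z: "z \<in> sector" "4 \<le> norm z"
    define R where "R = norm z"
    have R: "4 \<le> R" using z by (simp add: R_def)
    obtain s where s: "G (of_real R) = of_real (phi n k) + of_real s * cis (real k * a)"
      using G_slit[of R] R by auto
    have 2: "norm (G (of_real R) - G (of_real R * cis a)) \<le> 16 / R" using R by (intro arc) auto
    have "ht a (G (of_real R) - G (of_real R * cis a)) = - phi n k * sin a + s * S"
      using R by (simp add: ht_diff G_ray_on s ht_add ht_rcis S_def)
    then have "\<bar>- phi n k * sin a + s * S\<bar> \<le> 16 / R"
      using 2 ht_le_norm[of a "G (of_real R) - G (of_real R * cis a)"] by linarith
    moreover have "- phi n k * sin a + s * S = (s - L) * S" using S by (simp add: L_def S_def[symmetric] algebra_simps)
    ultimately have "\<bar>s - L\<bar> * S \<le> 16 / R" using S by (simp add: abs_mult)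
    then have "\<bar>s - L\<bar> \<le> 16 / R / S" using S by (subst pos_le_divide_eq)
    moreover have "norm (G (of_real R) - pt_P n k) = \<bar>s - L\<bar>"
      unfolding s pt_P_eq[OF assms] by (simp add: norm_mult flip: left_diff_distrib of_real_diff)
    moreover have "norm (G z - pt_P n k) \<le> norm (G z - G (of_real R * cis a)) + norm (G (of_real R) - G (of_real R * cis a)) + norm (G (of_real R) - pt_P n k)"
      using norm_triangle_ineq[of "(G z - G (of_real R * cis a)) - (G (of_real R) - G (of_real R * cis a))" "G (of_real R) - pt_P n k"]
        norm_triangle_ineq4[of "G z - G (of_real R * cis a)" "G (of_real R) - G (of_real R * cis a)"]
      by simp
    ultimately have "norm (G z - pt_P n k) \<le> 16 / R + 16 / R + 16 / R / S"
      using arc[of z R] z 2 R by (simp add: R_def)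
    also have "\<dots> = (32 + 16 / S) / R" by (simp add: add_divide_distrib)
    finally show "norm (G z - pt_P n k) \<le> (32 + 16 / S) / norm z" by (simp add: R_def)
  qed
qed

text \<open>For \<open>k = 1\<close> the image of the ray has no finite endpoint: (1 + t^n)^(-1/n)
  is at least 1/(1 + t), so its length grows at least logarithmically.\<close>

lemma G_ray_log:
  assumes "k = 1" "0 \<le> R"
  shows "ln (1 + R) \<le> norm (G (of_real R * cis a))"
proof -
  have "((\<lambda>t. cis a * integrand (0 + of_real t * cis a)) has_integral (G (0 + of_real R * cis a) - G (0 + of_real 0 * cis a))) {0..R}"
    by (rule G_FTC) (use assms sector_cis_a in auto)
  then have I1: "((\<lambda>t. Re (cis (- a) * (cis a * integrand (of_real t * cis a)))) has_integral Re (cis (- a) * G (of_real R * cis a))) {0..R}"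
    by (intro has_integral_Re has_integral_mult_right) simp
  have I2: "((\<lambda>t. 1 / (1 + t)) has_integral (ln (1 + R) - ln (1 + 0))) {0..R}"
    using assms by (intro fundamental_theorem_of_calculus)
      (auto intro!: derivative_eq_intros simp flip: has_real_derivative_iff_has_vector_derivative)
  have "1 / (1 + t) \<le> Re (cis (- a) * (cis a * integrand (of_real t * cis a)))" if "t \<in> {0..R}" for t
  proof -
    have t: "0 \<le> t" using that by simp
    have "1 / (1 + t) = (1 + t) powr (real n * (- \<beta>))"
    proof -
      have "real n * \<beta> = real k" using n0 by (simp add: \<beta>_def)
      then have "real n * (- \<beta>) = - 1" using assms(1) by (metis mult_minus_right of_nat_1)
      then show ?thesis using t by (simp only: powr_minus_divide) simp
    qed
    also have "\<dots> = ((1 + t) ^ n) powr (- \<beta>)"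
      using t by (simp add: powr_powr flip: powr_realpow)
    also have "\<dots> \<le> (1 + t ^ n) powr (- \<beta>)"
      using beta_pos n2 one_plus_power_le[OF t, of n] zero_le_power[OF t, of n]
      by (intro powr_mono2') linarith+
    also have "\<dots> = Re (cis (- a) * (cis a * integrand (of_real t * cis a)))"
      by (simp add: integrand_ray[OF t] cis_mult flip: mult.assoc)
    finally show ?thesis .
  qed
  then have "ln (1 + R) - ln (1 + 0) \<le> Re (cis (- a) * G (of_real R * cis a))"
    by (rule has_integral_le[OF I2 I1])
  also have "\<dots> \<le> norm (cis (- a) * G (of_real R * cis a))" by (rule complex_Re_le_cmod)
  finally show ?thesis by (simp add: norm_mult)
qed

text \<open>Substitute for properness: far points of the sector have images bounded away from
  \<open>w\<close>, because these approach P for \<open>k > 1\<close> and go to infinity for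
  \<open>k = 1\<close>.\<close>

lemma G_escape:
  assumes "k = 1 \<or> w \<noteq> pt_P n k"
  obtains R e where "e > 0" "\<And>z. z \<in> sector \<Longrightarrow> R \<le> norm z \<Longrightarrow> e \<le> norm (G z - w)"
proof (cases "k = 1")
  case True
  \<comment> \<open>Of the 9, the chord bound for \<open>k = 1\<close> takes 8, and 1 is the
    distance to be kept from \<open>w\<close>.\<close>
  define R where "R = max 4 (exp (norm w + 9))"
  have "1 \<le> norm (G z - w)" if z: "z \<in> sector" "R \<le> norm z" for z
  proof -
    define r where "r = norm z"
    have r: "4 \<le> r" "exp (norm w + 9) \<le> r" using z by (auto simp: r_def R_def)
    have "norm w + 9 = ln (exp (norm w + 9))" by simp
    also have "\<dots> \<le> ln (1 + r)" using r by (subst ln_le_cancel_iff) (auto intro: add_pos_pos)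
    also have "\<dots> \<le> norm (G (of_real r * cis a))" using True r by (intro G_ray_log) auto
    finally have "norm w + 9 \<le> norm (G (of_real r * cis a))" .
    moreover have "norm (G z - G (of_real r * cis a)) \<le> 8"
      using G_arc[OF z(1), of r] r unfolding True by (simp add: r_def split: if_splits)
    ultimately show ?thesis
      using norm_triangle_ineq[of "G z - w" w] norm_triangle_ineq2[of "G (of_real r * cis a)" "G z"]
        norm_minus_commute[of "G z" "G (of_real r * cis a)"] by simp
  qed
  then show ?thesis using that[of 1 R] by auto
next
  case False
  then have k: "k > 1" using k1 by simp
  obtain K where K: "K > 0" "\<And>z. z \<in> sector \<Longrightarrow> 4 \<le> norm z \<Longrightarrow> norm (G z - pt_P n k) \<le> K / norm z"
    using G_at_infinity[OF k] by blast
  define e where "e = norm (w - pt_P n k) / 2"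
  have e: "e > 0" using assms False by (simp add: e_def)
  define R where "R = max 4 (K / e)"
  have "e \<le> norm (G z - w)" if z: "z \<in> sector" "R \<le> norm z" for z
  proof -
    have *: "4 \<le> norm z" "K / e \<le> norm z" using z by (auto simp: R_def)
    then have "K \<le> norm z * e" using e by (simp add: divide_le_eq)
    moreover have "0 < norm z" using * by linarith
    ultimately have "K / norm z \<le> e" by (simp add: divide_le_eq mult.commute)
    then have "norm (G z - pt_P n k) \<le> e" using K(2)[OF z(1)] * by linarith
    moreover have "norm (w - pt_P n k) = 2 * e" by (simp add: e_def)
    moreover have "norm (w - pt_P n k) \<le> norm (G z - pt_P n k) + norm (G z - w)"
      using norm_triangle_ineq4[of "G z - pt_P n k" "G z - w"] by simp
    ultimately show ?thesis by linarith
  qed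
  then show ?thesis using that[of e R] e by auto
qed

text \<open>The part of the sector in a disc has a compact image, and the image of the rest stays
  away from \<open>w\<close> by \<open>G_escape\<close>.\<close>

lemma closure_G_sector:
  assumes "w \<in> closure (G ` sector)" "k = 1 \<or> w \<noteq> pt_P n k"
  shows "w \<in> G ` sector"
proof -
  obtain R e where e: "e > 0" "\<And>z. z \<in> sector \<Longrightarrow> R \<le> norm z \<Longrightarrow> e \<le> norm (G z - w)"
    using G_escape[OF assms(2)] by blast
  have "sector = (sector \<inter> cball 0 R) \<union> (sector - cball 0 R)" by auto
  then have "closure (G ` sector) = closure (G ` (sector \<inter> cball 0 R)) \<union> closure (G ` (sector - cball 0 R))"
    by (metis closure_Un image_Un)
  moreover have "w \<notin> closure (G ` (sector - cball 0 R))"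
  proof
    assume "w \<in> closure (G ` (sector - cball 0 R))"
    then obtain z where "z \<in> sector - cball 0 R" "dist (G z) w < e"
      using e(1) by (auto simp: closure_approachable)
    then show False using e(2)[of z] by (simp add: dist_norm)
  qed
  moreover have "compact (G ` (sector \<inter> cball 0 R))"
    by (intro compact_continuous_image continuous_on_subset[OF G_cont] closed_Int_compact closed_sector) auto
  then have "closure (G ` (sector \<inter> cball 0 R)) = G ` (sector \<inter> cball 0 R)"
    by (simp add: compact_imp_closed)
  ultimately show ?thesis using assms(1) by auto
qed

text \<open>A frontier point of the open image inside the connected interior would be a value of
  \<open>G\<close>, hence the image of an edge point. But edges go to the three bounding lines, and
  P lies on one of them too.\<close>

lemma interior_piece_subset: "interior piece \<subseteq> G ` interior sector"
proof (rule ccontr)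
  assume not: "\<not> interior piece \<subseteq> G ` interior sector"
  have "cis (a / 2) \<in> interior sector"
    using a_pos a_lt_pi2 sin_gt_zero[of "a / 2"] sin_minus[of "a / 2"] by (simp add: interior_sector)
  then have "interior piece \<inter> G ` interior sector \<noteq> {}" using G_interior by blast
  moreover have "connected (interior piece)" by (intro convex_connected convex_interior convex_piece)
  ultimately have "interior piece \<inter> frontier (G ` interior sector) \<noteq> {}"
    using not by (intro connected_Int_frontier) auto
  then obtain u where u: "u \<in> interior piece" "u \<in> closure (G ` interior sector)" "u \<notin> G ` interior sector"
    using G_open_interior by (auto simp: frontier_def interior_open)
  note uD = interior_piece[OF u(1)]
  have "u \<in> closure (G ` sector)" using u(2) closure_mono[OF image_mono[OF interior_subset]] by blast
  moreover have "k = 1 \<or> u \<noteq> pt_P n k" using uD ht_pt_P k1 by force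
  ultimately obtain z where z: "z \<in> sector" "u = G z" using closure_G_sector by blast
  from z(1) show False
  proof (cases rule: sector_cases)
    case 1
    then show ?thesis using z u by blast
  next
    case (2 x)
    show ?thesis
    proof (cases "x < 1")
      case True
      then obtain y where "G (of_real x) = of_real y" using G_unit_less[OF 2(2)] by metis
      then show ?thesis using uD z 2 by simp
    next
      case False
      then obtain s where "G (of_real x) = of_real (phi n k) + of_real s * cis (real k * a)"
        using G_slit[of x] by auto
      then show ?thesis using uD z 2 by (simp add: ht_rcis)
    qed
  next
    case (3 x)
    then show ?thesis using uD z G_ray_on[of x] by simp
  qed
qed

lemma interior_piece_nonempty: "interior piece \<noteq> {}"
proof -
  have "cis (a / 2) \<in> interior sector"
    using a_pos a_lt_pi2 sin_gt_zero[of "a / 2"] sin_minus[of "a / 2"] by (simp add: interior_sector)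
  then show ?thesis using G_interior by blast
qed

lemma closure_interior_piece: "closure (interior piece) = piece"
  using convex_closure_interior[OF convex_piece interior_piece_nonempty] closed_piece by simp

text \<open>P is a limit at infinity, so \<open>G_inv\<close> is studied away from it; for
  \<open>k = 1\<close> nothing is removed.\<close>

definition piece' :: "complex set" where
  "piece' = {w \<in> piece. k = 1 \<or> w \<noteq> pt_P n k}"

lemma piece'_subset: "piece' \<subseteq> G ` sector"
proof
  fix w assume w: "w \<in> piece'"
  have "interior piece \<subseteq> G ` sector" using interior_piece_subset interior_subset by blast
  then have "piece \<subseteq> closure (G ` sector)" using closure_mono closure_interior_piece by metis
  then show "w \<in> G ` sector" using w closure_G_sector by (auto simp: piece'_def)
qed

definition G_inv :: "complex \<Rightarrow> complex" where "G_inv = inv_into sector G"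

lemma G_inv_sector: "w \<in> piece' \<Longrightarrow> G_inv w \<in> sector" and G_G_inv: "w \<in> piece' \<Longrightarrow> G (G_inv w) = w"
  using piece'_subset by (auto simp: G_inv_def inv_into_into f_inv_into_f)

text \<open>Near \<open>w\<close> the preimages stay in a fixed disc by \<open>G_escape\<close>, and
  there \<open>G_lower\<close> makes the inverse Lipschitz with constant
  \<open>1 / low R'\<close>.\<close>

lemma G_inv_cont: "continuous_on piece' G_inv"
  unfolding continuous_on_iff
proof (intro ballI allI impI)
  fix w and \<epsilon> :: real assume w: "w \<in> piece'" and \<epsilon>: "0 < \<epsilon>"
  obtain R e where e: "e > 0" "\<And>z. z \<in> sector \<Longrightarrow> R \<le> norm z \<Longrightarrow> e \<le> norm (G z - w)"
    using G_escape[of w] w unfolding piece'_def by blast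
  define R' where "R' = max R (norm (G_inv w))"
  have low: "0 < low R'" by (intro low_pos) (auto simp: R'_def le_max_iff_disj)
  show "\<exists>d>0. \<forall>w'\<in>piece'. dist w' w < d \<longrightarrow> dist (G_inv w') (G_inv w) < \<epsilon>"
  proof (intro exI[of _ "min e (low R' * \<epsilon>)"] conjI ballI impI)
    show "0 < min e (low R' * \<epsilon>)" using e low \<epsilon> by simp
    fix w' assume w': "w' \<in> piece'" "dist w' w < min e (low R' * \<epsilon>)"
    then have "norm (G_inv w') \<le> R'"
      using e(2)[OF G_inv_sector[OF w'(1)]] by (fastforce simp: G_G_inv dist_norm R'_def)
    then have "low R' * norm (G_inv w' - G_inv w) \<le> norm (G (G_inv w') - G (G_inv w))"
      using w w' by (intro G_lower G_inv_sector) (auto simp: R'_def)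
    also have "\<dots> < low R' * \<epsilon>" using w w' by (simp add: G_G_inv dist_norm)
    finally show "dist (G_inv w') (G_inv w) < \<epsilon>" using low by (simp add: dist_norm)
  qed
qed

end

section \<open>Extension by rotations and reflection\<close>

text \<open>Along the segment from 0 the difference has derivative 0. Derivatives within
  \<open>S\<close> suffice, so it also applies to \<open>sector \<inter> slit_plane\<close>, which
  is not open.\<close>

lemma starlike_primitive_unique:
  fixes f g :: "complex \<Rightarrow> complex"
  assumes "closed_segment 0 z \<subseteq> S" "f 0 = g 0"
    and "\<And>z. z \<in> S \<Longrightarrow> (f has_field_derivative p z) (at z within S)"
    and "\<And>z. z \<in> S \<Longrightarrow> (g has_field_derivative p z) (at z within S)"
  shows "f z = g z"
proof -
  have "\<exists>c. \<forall>x\<in>closed_segment 0 z. f x - g x = c"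
  proof (rule has_field_derivative_zero_constant)
    fix x assume "x \<in> closed_segment 0 z"
    then have "((\<lambda>x. f x - g x) has_field_derivative p x - p x) (at x within closed_segment 0 z)"
      using assms(1) by (intro DERIV_diff DERIV_subset[OF assms(3)] DERIV_subset[OF assms(4)]) auto
    then show "((\<lambda>x. f x - g x) has_field_derivative 0) (at x within closed_segment 0 z)" by simp
  qed simp
  then obtain c where "\<And>x. x \<in> closed_segment 0 z \<Longrightarrow> f x - g x = c" by blast
  then have "f z - g z = f 0 - g 0" by simp
  then show ?thesis using assms(2) by simp
qed

context sc_map
begin

abbreviation slit_plane :: "complex set" where "slit_plane \<equiv> Sigma_slit n"

lemma dih_power: "dih j e z ^ n = (if e then cnj (z ^ n) else z ^ n)"
proof -
  have "cis (2 * a * of_int j) ^ n = cis (2 * pi * of_int j)"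
    unfolding Complex.DeMoivre by (simp add: ac_simps flip: na)
  then have "cis (2 * a * of_int j) ^ n = 1" by simp
  then show ?thesis by (simp add: dih_def power_mult_distrib)
qed

lemma dih_of_real: "dih j e (of_real x) = dih j False (of_real x)"
  by (simp add: dih_def)

lemma slit_plane_dih: "z \<in> sector \<Longrightarrow> dih j e z \<in> slit_plane \<longleftrightarrow> z \<notin> of_real ` {1..}"
proof -
  assume z: "z \<in> sector"
  have "dih j e z \<notin> slit_plane \<longleftrightarrow> (\<exists>i. \<exists>x\<ge>1. dih j e z = dih i False (of_real x))"
    by (auto simp: Sigma_slit_def rotations_iff)
  also have "\<dots> \<longleftrightarrow> z \<in> of_real ` {1..}"
  proof
    assume "\<exists>i. \<exists>x\<ge>1. dih j e z = dih i False (of_real x)"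
    then obtain i x where x: "x \<ge> 1" "dih j e z = dih i False (of_real x)" by blast
    then have "z = of_real x" using dih_eq(1)[OF z _ x(2)] by simp
    then show "z \<in> of_real ` {1..}" using x by auto
  next
    assume "z \<in> of_real ` {1..}"
    then obtain x where "1 \<le> x" "z = of_real x" by auto
    then show "\<exists>i. \<exists>x\<ge>1. dih j e z = dih i False (of_real x)" using dih_of_real by blast
  qed
  finally show ?thesis by blast
qed

lemma sector_power_ge_1:
  assumes "z \<in> sector" "Im (z ^ n) = 0" "1 \<le> Re (z ^ n)"
  shows "z \<in> of_real ` {1..}"
  using assms(1)
proof (cases rule: sector_cases)
  case 1
  then show ?thesis using sector_power(3)[OF assms(1)] assms by simp
next
  case (2 x)
  then have "1 \<le> x ^ n" using assms(3) by (simp flip: of_real_power)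
  then have "1 \<le> x" using 2 n0 power_less_one_iff[of x n] by (meson linorder_not_le of_nat_0_less_iff)
  then show ?thesis using 2 by auto
next
  case (3 x)
  then have "z ^ n = of_real (- (x ^ n))" by (simp add: power_mult_distrib cis_a_power)
  then have "1 \<le> - (x ^ n)" using assms(3) by simp
  then show ?thesis using zero_le_power[OF 3(2), of n] by linarith
qed

text \<open>The slits together are the preimage under the \<open>n\<close>-th power of the real
  half-line starting at 1. This form is visibly invariant under the symmetries and leads to the set
  where the principal power of 1 - z^n is holomorphic.\<close>

lemma slit_plane_iff: "z \<in> slit_plane \<longleftrightarrow> \<not> (Im (z ^ n) = 0 \<and> 1 \<le> Re (z ^ n))"
proof -
  obtain j e u where u: "u \<in> sector" "z = dih j e u" using dih_cover[of z] by blast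
  have "Im (z ^ n) = 0 \<and> 1 \<le> Re (z ^ n) \<longleftrightarrow> Im (u ^ n) = 0 \<and> 1 \<le> Re (u ^ n)"
    unfolding u(2) dih_power by (cases e) (simp_all del: complex_cnj_power)
  also have "\<dots> \<longleftrightarrow> u \<in> of_real ` {1..}"
    using sector_power_ge_1[OF u(1)] by (auto simp flip: of_real_power)
  finally show ?thesis using slit_plane_dih[OF u(1)] u(2) by blast
qed

lemma slit_plane_nonpos: "z \<in> slit_plane \<longleftrightarrow> 1 - z ^ n \<notin> \<real>\<^sub>\<le>\<^sub>0"
  unfolding slit_plane_iff complex_nonpos_Reals_iff by auto

lemma open_slit_plane: "open slit_plane"
proof -
  have "slit_plane = (\<lambda>z. 1 - z ^ n) -` (- \<real>\<^sub>\<le>\<^sub>0)" using slit_plane_nonpos by auto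
  moreover have "open ((\<lambda>z::complex. 1 - z ^ n) -` (- \<real>\<^sub>\<le>\<^sub>0))"
    by (intro open_vimage continuous_intros open_Compl closed_nonpos_Reals_complex)
  ultimately show ?thesis by simp
qed

lemma segment_slit_plane:
  assumes "z \<in> slit_plane" shows "closed_segment 0 z \<subseteq> slit_plane"
proof
  fix w assume "w \<in> closed_segment 0 z"
  then obtain t where t: "0 \<le> t" "t \<le> 1" "w = of_real t * z"
    by (auto simp: in_segment scaleR_conv_of_real)
  have wn: "w ^ n = of_real (t ^ n) * z ^ n" by (simp add: t power_mult_distrib)
  show "w \<in> slit_plane"
  proof (rule ccontr)
    assume "w \<notin> slit_plane"
    then have *: "t ^ n * Im (z ^ n) = 0" "1 \<le> t ^ n * Re (z ^ n)" using wn by (auto simp: slit_plane_iff)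
    have tn: "0 \<le> t ^ n" "t ^ n \<le> 1" using t by (auto simp: power_le_one)
    have "t ^ n \<noteq> 0" using *(2) n2 by (auto simp: power_0_left)
    then have "Im (z ^ n) = 0" using *(1) by (metis mult_eq_0_iff)
    moreover have "0 < Re (z ^ n)" using *(2) tn by (metis mult_nonneg_nonpos not_less not_one_le_zero order_trans)
    then have "t ^ n * Re (z ^ n) \<le> 1 * Re (z ^ n)" using tn by (intro mult_right_mono) auto
    then have "1 \<le> Re (z ^ n)" using *(2) by simp
    ultimately show False using assms by (simp add: slit_plane_iff)
  qed
qed

lemma zero_slit_plane: "0 \<in> slit_plane" using n2 by (simp add: slit_plane_iff power_0_left)

section \<open>The primitive of the principal branch on the slit plane\<close>

definition Fp :: "complex \<Rightarrow> complex" where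
  "Fp z = (1 - z ^ n) powr (- of_real \<beta>)"

lemma F_exists: "\<exists>F. F 0 = 0 \<and> (\<forall>z\<in>slit_plane. (F has_field_derivative Fp z) (at z))"
proof -
  have diff: "Fp field_differentiable at z" if "z \<in> slit_plane" for z
  proof -
    have nn: "1 - z ^ n \<notin> \<real>\<^sub>\<le>\<^sub>0" using that slit_plane_nonpos by blast
    have d: "((\<lambda>z. 1 - z ^ n) has_field_derivative - (of_nat n * z ^ (n - 1))) (at z)"
      by (auto intro!: derivative_eq_intros)
    show ?thesis
      unfolding Fp_def field_differentiable_def
      by (rule exI, rule DERIV_chain2[OF has_field_derivative_powr[OF nn] d])
  qed
  have "\<exists>g. \<forall>x\<in>slit_plane. (g has_field_derivative Fp x) (at x)"
  proof (rule holomorphic_starlike_primitive[of _ _ "{}"])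
    show "continuous_on slit_plane Fp"
      using diff field_differentiable_imp_continuous_at continuous_at_imp_continuous_on by blast
    show "starlike slit_plane" unfolding starlike_def using zero_slit_plane segment_slit_plane by blast
  qed (use open_slit_plane diff in auto)
  then obtain g where g: "\<And>x. x \<in> slit_plane \<Longrightarrow> (g has_field_derivative Fp x) (at x)" by blast
  have "\<forall>z\<in>slit_plane. ((\<lambda>z. g z - g 0) has_field_derivative Fp z) (at z)"
    by (auto intro!: derivative_eq_intros g)
  then show ?thesis by (intro exI[of _ "\<lambda>z. g z - g 0"]) simp
qed

definition F :: "complex \<Rightarrow> complex" where
  "F = (SOME F. F 0 = 0 \<and> (\<forall>z\<in>slit_plane. (F has_field_derivative Fp z) (at z)))"

lemma F_0 [simp]: "F 0 = 0" and F_deriv: "z \<in> slit_plane \<Longrightarrow> (F has_field_derivative Fp z) (at z)"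
  using someI_ex[OF F_exists] by (auto simp: F_def)

lemma F_holo: "F holomorphic_on slit_plane"
  using F_deriv open_slit_plane by (auto simp: holomorphic_on_open)

lemma F_unique:
  assumes "f 0 = 0" "\<And>z. z \<in> slit_plane \<Longrightarrow> (f has_field_derivative Fp z) (at z)" "z \<in> slit_plane"
  shows "f z = F z"
  using segment_slit_plane[OF assms(3)] assms(1)
  by (intro starlike_primitive_unique[of z slit_plane f F Fp])
    (auto intro: has_field_derivative_at_within assms(2) F_deriv)

lemma slit_plane_dih_iff: "dih j e z \<in> slit_plane \<longleftrightarrow> z \<in> slit_plane"
  unfolding slit_plane_iff dih_power by (simp del: complex_cnj_power)

lemma Fp_dih: assumes "z \<in> slit_plane" shows "Fp (dih j e z) = (if e then cnj (Fp z) else Fp z)"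
proof -
  have "cnj ((1 - z ^ n) powr (- of_real \<beta>)) = cnj (1 - z ^ n) powr (cnj (- of_real \<beta>))"
    using assms by (intro cnj_powr) (auto simp: slit_plane_nonpos complex_nonpos_Reals_iff)
  then show ?thesis by (simp add: Fp_def dih_power)
qed

text \<open>Conjugating \<open>F\<close> by a symmetry yields again a primitive of \<open>Fp\<close>
  vanishing at 0. Rotations and complex conjugation are treated apart, since the latter must be
  applied on both sides of \<open>F\<close> to keep it holomorphic.\<close>

lemma F_dih: assumes "z \<in> slit_plane" shows "F (dih j e z) = dih j e (F z)"
proof -
  have rot: "F (dih j False z) = dih j False (F z)" if z: "z \<in> slit_plane" for z
  proof -
    define c where "c = cis (2 * a * of_int j)"
    have c0: "c \<noteq> 0" by (simp add: c_def)
    have "(\<lambda>z. inverse c * F (c * z)) z = F z"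
    proof (rule F_unique[OF _ _ z])
      fix w assume w: "w \<in> slit_plane"
      have "c * w \<in> slit_plane" using slit_plane_dih_iff[of j False w] w by (simp add: dih_def c_def)
      then have "((\<lambda>z. inverse c * F (c * z)) has_field_derivative inverse c * (Fp (c * w) * c)) (at w)"
        by (intro DERIV_cmult DERIV_chain2[OF F_deriv]) (auto intro!: derivative_eq_intros)
      moreover have "Fp (c * w) = Fp w" using Fp_dih[OF w, of j False] by (simp add: dih_def c_def)
      moreover have "inverse c * (Fp w * c) = Fp w" using c0 by simp
      ultimately show "((\<lambda>z. inverse c * F (c * z)) has_field_derivative Fp w) (at w)"
        by (simp only:)
    qed simp
    then have "F (c * z) = c * F z" using c0 by (simp add: field_simps)
    then show ?thesis by (simp add: dih_def c_def)
  qed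
  have conj: "F (cnj z) = cnj (F z)" if z: "z \<in> slit_plane" for z
  proof -
    have "(cnj \<circ> F \<circ> cnj) z = F z"
    proof (rule F_unique[OF _ _ z])
      fix w assume w: "w \<in> slit_plane"
      have "cnj w \<in> slit_plane" "Fp (cnj w) = cnj (Fp w)"
        using slit_plane_dih_iff[of 0 True w] Fp_dih[of w 0 True] w by (auto simp: dih_def)
      then show "((cnj \<circ> F \<circ> cnj) has_field_derivative Fp w) (at w)"
        using has_field_derivative_cnj_cnj[of F "Fp (cnj w)" w] F_deriv[of "cnj w"] by simp
    qed simp
    then show ?thesis by (metis comp_apply complex_cnj_cnj)
  qed
  have "cnj z \<in> slit_plane" using slit_plane_dih_iff[of 0 True z] assms by (simp add: dih_def)
  then show ?thesis using rot[of "cnj z"] rot[of z] conj[OF assms] assms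
    by (cases e) (auto simp: dih_def)
qed

text \<open>On the sector 1 - z^n is in the closed lower half-plane, here off the nonpositive axis;
  there multiplication by \<i> adds exactly pi/2 to the argument without crossing the cut.\<close>

lemma integrand_eq_Fp: assumes "z \<in> sector" "z \<in> slit_plane" shows "integrand z = Fp z"
proof -
  define u where "u = 1 - z ^ n"
  have "u \<notin> \<real>\<^sub>\<le>\<^sub>0" "Im u \<le> 0" using assms sector_power(1) by (auto simp: u_def slit_plane_nonpos)
  then have u: "u \<noteq> 0" "0 \<le> Re u \<or> Im u < 0" by (auto simp: complex_nonpos_Reals_iff)
  have "Ln (\<i> * u) = Ln u + \<i> * of_real (pi / 2)"
    using Ln_times_ii[OF u(1)] u(2) by simp
  then have "(\<i> * u) powr (- of_real \<beta>) = exp (- of_real \<beta> * Ln u + \<i> * of_real (- (\<beta> * pi / 2)))"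
    using u(1) by (simp add: powr_def algebra_simps)
  also have "\<dots> = u powr (- of_real \<beta>) * cis (- (\<beta> * pi / 2))"
    using u(1) by (simp only: exp_add cis_conv_exp powr_def) simp
  finally show ?thesis by (simp add: integrand_def vv_def Fp_def cis_mult mult.left_commute[of "cis _"] flip: u_def)
qed

lemma F_eq_G: assumes "z \<in> sector" "z \<in> slit_plane" shows "F z = G z"
proof (rule starlike_primitive_unique[of z "sector \<inter> slit_plane" F G Fp])
  have "closed_segment 0 z \<subseteq> sector" using convex_sector assms by (simp add: convex_contains_segment)
  then show "closed_segment 0 z \<subseteq> sector \<inter> slit_plane" using segment_slit_plane[OF assms(2)] by blast
  have "1 \<notin> slit_plane" by (simp add: slit_plane_iff)
  then show "(G has_field_derivative Fp w) (at w within sector \<inter> slit_plane)" if "w \<in> sector \<inter> slit_plane" for w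
    using that integrand_eq_Fp[of w] G_deriv[of w] by (metis DERIV_subset Int_iff inf_le1)
qed (auto intro: has_field_derivative_at_within F_deriv)

lemma slit_plane_cover:
  assumes "y \<in> slit_plane"
  obtains j e z where "z \<in> sector" "z \<notin> of_real ` {1..}" "z \<in> slit_plane" "y = dih j e z" "F y = dih j e (G z)"
proof -
  obtain j e z where z: "z \<in> sector" "y = dih j e z" using dih_cover[of y] by blast
  then have "z \<in> slit_plane" using assms slit_plane_dih_iff by blast
  then show ?thesis using that[of z j e] z slit_plane_dih[of z j e] assms F_dih F_eq_G by simp
qed

lemma not_slit_slit_plane: "z \<in> sector \<Longrightarrow> z \<notin> of_real ` {1..} \<Longrightarrow> z \<in> slit_plane"
  using slit_plane_dih[of z 0 False] by simp

lemma G_sector: "z \<in> sector \<Longrightarrow> G z \<in> sector"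
  using G_in_piece piece_subset_sector by blast

text \<open>Equal images force \<open>G z = G z'\<close>, so \<open>z = z'\<close> by injectivity;
  the symmetries then agree at \<open>z\<close> as well, because each mirror through
  \<open>G z\<close> also contains \<open>z\<close>.\<close>

lemma dih_G_eq:
  assumes "z \<in> sector" "z' \<in> sector" "dih i d (G z) = dih j e (G z')"
  shows "z = z'" "dih i d z = dih j e z'"
proof -
  have "G z = G z'" using dih_eq(1)[OF _ _ assms(3)] G_sector assms by blast
  then show eq: "z = z'" using G_inj assms by (auto dest: inj_onD)
  have "z = 0" if "G z = 0" using that inj_onD[OF G_inj, of z 0] assms by simp
  then show "dih i d z = dih j e z'"
    using dih_eq(2)[OF _ _ assms(3), of z] G_sector assms eq G_Im_zero(1)[OF assms(1)] G_ht_zero[OF assms(1)]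
    by simp
qed

section \<open>The symmetric extension of the inverse\<close>

text \<open>Defined by transport rather than as the inverse of \<open>F\<close>, so that one
  function serves the interior and the boundary edges.\<close>

definition S_ext :: "complex \<Rightarrow> complex" where
  "S_ext w = (THE y. \<exists>j e. \<exists>z\<in>sector. w = dih j e (G z) \<and> y = dih j e z)"

lemma S_ext_dih: assumes "z \<in> sector" shows "S_ext (dih j e (G z)) = dih j e z"
  unfolding S_ext_def
proof (rule the_equality)
  show "\<exists>ja ea. \<exists>za\<in>sector. dih j e (G z) = dih ja ea (G za) \<and> dih j e z = dih ja ea za"
    using assms by blast
qed (use dih_G_eq(2) assms in metis)

lemma S_ext_F: "y \<in> slit_plane \<Longrightarrow> S_ext (F y) = y"
  by (metis slit_plane_cover S_ext_dih)

lemma F_inj: "inj_on F slit_plane"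
  by (metis S_ext_F inj_onI)

definition image_F :: "complex set" where "image_F = F ` slit_plane"

lemma image_F_iff: "w \<in> image_F \<longleftrightarrow> (\<exists>j e. \<exists>z\<in>sector. z \<notin> of_real ` {1..} \<and> w = dih j e (G z))"
proof
  assume "w \<in> image_F"
  then show "\<exists>j e. \<exists>z\<in>sector. z \<notin> of_real ` {1..} \<and> w = dih j e (G z)"
    unfolding image_F_def using slit_plane_cover by (metis imageE)
next
  assume "\<exists>j e. \<exists>z\<in>sector. z \<notin> of_real ` {1..} \<and> w = dih j e (G z)"
  then obtain j e z where z: "z \<in> sector" "z \<notin> of_real ` {1..}" "w = dih j e (G z)" by blast
  then have "z \<in> slit_plane" by (intro not_slit_slit_plane)
  then have "dih j e z \<in> slit_plane" "w = F (dih j e z)" using z F_dih F_eq_G by (auto simp: slit_plane_dih_iff)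
  then show "w \<in> image_F" unfolding image_F_def by blast
qed

lemma open_image_F: "open image_F"
  unfolding image_F_def by (intro open_mapping_thm3 F_holo open_slit_plane F_inj)

lemma connected_image_F: "connected image_F"
  unfolding image_F_def
proof (intro connected_continuous_image holomorphic_on_imp_continuous_on F_holo)
  show "connected slit_plane" by (intro starlike_imp_connected) (auto simp: starlike_def intro!: bexI[of _ 0] zero_slit_plane dest: segment_slit_plane)
qed

lemma S_ext_biholo: "biholomorphism image_F slit_plane S_ext"
  unfolding biholomorphism_def
proof (intro conjI)
  show bij: "bij_betw S_ext image_F slit_plane"
    unfolding image_F_def by (rule bij_betwI[of _ _ _ F]) (auto simp: S_ext_F)
  obtain g where g: "g holomorphic_on (F ` slit_plane)" "\<And>z. z \<in> slit_plane \<Longrightarrow> g (F z) = z"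
    using holomorphic_has_inverse[OF F_holo open_slit_plane F_inj] by metis
  show "S_ext holomorphic_on image_F"
    using g unfolding image_F_def by (subst holomorphic_cong[of _ "F ` slit_plane" _ g]) (auto simp: S_ext_F)
  have "inv_into image_F S_ext y = F y" if "y \<in> slit_plane" for y
    using that bij by (intro inv_into_f_eq) (auto simp: bij_betw_def image_F_def S_ext_F)
  then show "inv_into image_F S_ext holomorphic_on slit_plane"
    using F_holo by (subst holomorphic_cong[of _ slit_plane _ F]) auto
qed

section \<open>The union of all pieces, its interior and its closure\<close>

definition star :: "complex set" where "star = (\<Union>j\<in>{0..<int n}. \<Union>e. dih j e ` piece)"

lemma dih_mod_in: "j mod int n \<in> {0..<int n}" using n2 by simp

lemma star_iff: "w \<in> star \<longleftrightarrow> (\<exists>j e. \<exists>z\<in>piece. w = dih j e z)"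
proof
  assume "\<exists>j e. \<exists>z\<in>piece. w = dih j e z"
  then obtain j e z where "z \<in> piece" "w = dih (j mod int n) e z" by (metis dih_mod)
  then show "w \<in> star" unfolding star_def using dih_mod_in by blast
qed (auto simp: star_def)

lemma dih_image: "dih j e ` A = dinv j e -` A"
  by (auto simp: image_iff) (metis dih_dinv)

lemma closed_dih: "closed A \<Longrightarrow> closed (dih j e ` A)"
  unfolding dih_image by (intro closed_vimage continuous_on_dinv continuous_on_id)

lemma closed_star: "closed star"
  unfolding star_def by (intro closed_UN ballI closed_dih closed_piece) auto

lemma S_ext_G_inv:
  assumes "w \<in> piece'" shows "S_ext (dih j e w) = dih j e (G_inv w)"
  using S_ext_dih[OF G_inv_sector[OF assms]] G_G_inv[OF assms] by metis

definition star' :: "complex set" where "star' = (\<Union>j\<in>{0..<int n}. \<Union>e. dih j e ` piece')"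

lemma piece'_piece: "piece' \<subseteq> piece" by (auto simp: piece'_def)

lemma S_ext_cont: "continuous_on star' S_ext"
proof -
  have key: "(dih j e \<circ> G_inv \<circ> dinv j e) w = S_ext w" if "w \<in> dih j e ` piece'" for j e w
    using that by (auto simp: S_ext_G_inv)
  have "continuous_map (top_of_set star') euclidean S_ext"
  proof (rule pasting_lemma_closed[of "{0..<int n} \<times> UNIV" _ "\<lambda>(j, e). dih j e ` piece'" _ "\<lambda>(j, e). dih j e \<circ> G_inv \<circ> dinv j e"])
    fix i assume "i \<in> {0..<int n} \<times> (UNIV :: bool set)"
    then obtain j e where i: "i = (j, e)" "j \<in> {0..<int n}" by auto
    have sub: "dih j e ` piece' \<subseteq> star'" using i unfolding star'_def by blast
    \<comment> \<open>The copies of \<open>piece'\<close> have to be relatively closed for pasting: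
      a point of \<open>star'\<close> in a closed copy of \<open>piece\<close> has the same sector
      representative in both, so it is not a copy of P.\<close>
    have "star' \<inter> dih j e ` piece \<subseteq> dih j e ` piece'"
    proof
      fix w assume w: "w \<in> star' \<inter> dih j e ` piece"
      then obtain l f u' where u': "u' \<in> piece'" "w = dih l f u'" by (auto simp: star'_def)
      obtain u where u: "u \<in> piece" "w = dih j e u" using w by auto
      have "u = u'" using dih_eq(1)[of u u' j e l f] u u' piece_subset_sector piece'_piece by auto
      then show "w \<in> dih j e ` piece'" using u u' by auto
    qed
    then have eq: "dih j e ` piece' = star' \<inter> dih j e ` piece" using sub piece'_piece by blast
    show "closedin (top_of_set star') (case i of (j, e) \<Rightarrow> dih j e ` piece')"
      unfolding i(1) prod.case eq by (intro closedin_closed_Int closed_dih closed_piece)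
    have "continuous_on (dih j e ` piece') (dih j e \<circ> G_inv \<circ> dinv j e)"
      unfolding o_def
      by (intro continuous_on_dih continuous_on_compose2[OF G_inv_cont] continuous_on_dinv continuous_on_id) auto
    then show "continuous_map (subtopology (top_of_set star') (case i of (j, e) \<Rightarrow> dih j e ` piece')) euclidean
        (case i of (j, e) \<Rightarrow> dih j e \<circ> G_inv \<circ> dinv j e)"
      using sub by (simp add: i(1) subtopology_subtopology Int_absorb1)
  next
    fix i i' w assume "w \<in> topspace (top_of_set star') \<inter> (case i of (j, e) \<Rightarrow> dih j e ` piece') \<inter> (case i' of (j, e) \<Rightarrow> dih j e ` piece')"
    then show "(case i of (j, e) \<Rightarrow> dih j e \<circ> G_inv \<circ> dinv j e) w = (case i' of (j, e) \<Rightarrow> dih j e \<circ> G_inv \<circ> dinv j e) w"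
      using key by (cases i; cases i') (simp only: prod.case Int_iff)
  next
    fix w assume "w \<in> topspace (top_of_set star')"
    then obtain l f where "l \<in> {0..<int n}" "w \<in> dih l f ` piece'"
      unfolding star'_def topspace_euclidean_subtopology by blast
    then show "\<exists>i. i \<in> {0..<int n} \<times> UNIV \<and> w \<in> (case i of (j, e) \<Rightarrow> dih j e ` piece') \<and>
        S_ext w = (case i of (j, e) \<Rightarrow> dih j e \<circ> G_inv \<circ> dinv j e) w"
      using key[of w l f] by (intro exI[of _ "(l, f)"]) (simp only: prod.case mem_Times_iff fst_conv snd_conv UNIV_I simp_thms)
  qed auto
  then show ?thesis by simp
qed

lemma G_slit_interior_sector: "1 < x \<Longrightarrow> G (of_real x) \<in> interior sector"
  using G_slit_Im[of x] G_slit_ht[of x] by (simp add: interior_sector)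

text \<open>The image of a slit point lies in the open sector. A small step outwards across the edge
  leaves \<open>piece\<close> within the same sector, and no other copy can cover the new point
  since the sector is a fundamental domain.\<close>

lemma slit_not_interior:
  assumes "1 < x" shows "dih j e (G (of_real x)) \<notin> interior star"
proof
  define u where "u = G (of_real x)"
  assume "dih j e (G (of_real x)) \<in> interior star"
  then obtain d1 where d1: "d1 > 0" "ball (dih j e u) d1 \<subseteq> star" unfolding u_def by (meson mem_interior)
  obtain d2 where d2: "d2 > 0" "ball u d2 \<subseteq> sector"
    using G_slit_interior_sector[OF assms] unfolding u_def by (meson mem_interior)
  define \<eta> where "\<eta> = min d1 d2 / 2"
  have \<eta>: "0 < \<eta>" "\<eta> < d1" "\<eta> < d2" using d1 d2 by (auto simp: \<eta>_def)
  define v where "v = u - of_real \<eta> * (\<i> * cis (real k * a))"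
  have "dist u v = \<eta>" using \<eta> by (simp add: v_def dist_norm norm_mult)
  then have "v \<in> sector" "dih j e v \<in> star"
    using \<eta> by (auto intro!: subsetD[OF d1(2)] subsetD[OF d2(2)])
  then obtain l f v' where v': "v' \<in> piece" "dih j e v = dih l f v'" by (auto simp: star_iff)
  then have "v \<in> piece" using dih_eq(1)[OF \<open>v \<in> sector\<close> _ v'(2)] piece_subset_sector by auto
  then have "0 \<le> ht (real k * a) (v - of_real (phi n k))" by (simp add: piece_def)
  also obtain s where s: "u = of_real (phi n k) + of_real s * cis (real k * a)"
    using G_slit[of x] assms unfolding u_def by (metis less_imp_le)
  have "ht (real k * a) (\<i> * cis (real k * a)) = 1" by (simp add: ht_eq power2_eq_square[symmetric])
  then have "ht (real k * a) (v - of_real (phi n k)) = - \<eta>"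
    unfolding v_def ht_diff s ht_add ht_of_real_mult by simp
  finally show False using \<eta> by simp
qed

text \<open>A closed condition, so the vertices A and P inherit it as limits of edge points.\<close>

lemma closed_not_interior: "closed {u. dih j e u \<notin> interior star}"
proof -
  have "closed (dih j e -` (- interior star))"
    by (intro closed_vimage continuous_on_dih continuous_on_id closed_Compl open_interior)
  moreover have "dih j e -` (- interior star) = {u. dih j e u \<notin> interior star}" by auto
  ultimately show ?thesis by simp
qed

lemma G_slit_tendsto_A: "((\<lambda>x. G (of_real x)) \<longlongrightarrow> G 1) (at_right 1)"
proof -
  have "((\<lambda>x. G (of_real x)) \<longlongrightarrow> G (of_real 1)) (at 1 within {1..})"
  proof -
    have "continuous_on {1..} (\<lambda>x::real. G (of_real x))"
      by (intro continuous_on_compose2[OF G_cont] continuous_intros) auto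
    then have "\<forall>x\<in>{1..}. ((\<lambda>x. G (of_real x)) \<longlongrightarrow> G (of_real x)) (at x within {1..})"
      by (simp only: continuous_on_def)
    then show ?thesis by (rule bspec) simp
  qed
  then have "((\<lambda>x. G (of_real x)) \<longlongrightarrow> G (of_real 1)) (at_right 1)"
    by (rule tendsto_within_subset) auto
  then show ?thesis by simp
qed

lemma A_not_interior: "dih j e (G 1) \<notin> interior star"
proof -
  have "G 1 \<in> {u. dih j e u \<notin> interior star}"
    by (rule Lim_in_closed_set[OF closed_not_interior _ _ G_slit_tendsto_A])
      (auto simp: eventually_at_right_field slit_not_interior intro!: exI[of _ 2])
  then show ?thesis by simp
qed

lemma G_slit_tendsto_P:
  assumes "k > 1" shows "((\<lambda>x. G (of_real x)) \<longlongrightarrow> pt_P n k) at_top"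
proof -
  obtain K where K: "K > 0" "\<And>z. z \<in> sector \<Longrightarrow> 4 \<le> norm z \<Longrightarrow> norm (G z - pt_P n k) \<le> K / norm z"
    using G_at_infinity[OF assms] by blast
  have "((\<lambda>x. G (of_real x) - pt_P n k) \<longlongrightarrow> 0) at_top"
  proof (rule Lim_null_comparison)
    show "\<forall>\<^sub>F x in at_top. norm (G (of_real x) - pt_P n k) \<le> K / x"
      using eventually_ge_at_top[of 4]
    proof eventually_elim
      case (elim x)
      then show ?case using K(2)[of "of_real x"] by simp
    qed
    show "((\<lambda>x. K / x) \<longlongrightarrow> 0) at_top"
      by (intro tendsto_divide_0[OF tendsto_const] filterlim_at_top_imp_at_infinity filterlim_ident)
  qed
  then show ?thesis by (simp add: LIM_zero_iff)
qed

lemma P_not_interior: assumes "k > 1" shows "dih j e (pt_P n k) \<notin> interior star"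
proof -
  have "\<forall>\<^sub>F x in at_top. dih j e (G (of_real x)) \<notin> interior star"
    using eventually_gt_at_top[of 1] by eventually_elim (rule slit_not_interior)
  then have "pt_P n k \<in> {u. dih j e u \<notin> interior star}"
    by (intro Lim_in_closed_set[OF closed_not_interior _ _ G_slit_tendsto_P[OF assms]]) auto
  then show ?thesis by simp
qed

lemma piece_cases:
  assumes "w \<in> piece"
  obtains z where "z \<in> sector" "z \<notin> of_real ` {1..}" "w = G z" | x where "1 \<le> x" "w = G (of_real x)" | "k > 1" "w = pt_P n k"
proof (cases "w \<in> piece'")
  case True
  then show ?thesis using that(1,2) G_inv_sector[OF True] G_G_inv[OF True, symmetric]
    by (cases "G_inv w \<in> of_real ` {1..}") auto
next
  case False
  then show ?thesis using that(3) assms k1 by (auto simp: piece'_def)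
qed

lemma interior_star: "interior star = image_F"
proof
  show "image_F \<subseteq> interior star"
    using open_image_F G_in_piece by (intro interior_maximal) (auto simp: star_iff image_F_iff, blast)
  show "interior star \<subseteq> image_F"
  proof
    fix w assume w: "w \<in> interior star"
    then have "w \<in> star" using interior_subset by blast
    then obtain j e u where u: "u \<in> piece" "w = dih j e u" by (auto simp: star_iff)
    from u(1) show "w \<in> image_F"
    proof (cases rule: piece_cases)
      case (1 z)
      then show ?thesis using u by (auto simp: image_F_iff)
    next
      case (2 x)
      then show ?thesis using slit_not_interior[of x] A_not_interior u w by (cases "x = 1") auto
    next
      case 3
      then show ?thesis using P_not_interior u w by auto
    qed
  qed
qed

lemma closure_image_F: "closure image_F = star"
proof
  show "closure image_F \<subseteq> star" using closed_star interior_subset[of star] by (intro closure_minimal) (auto simp: interior_star)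
  show "star \<subseteq> closure image_F"
  proof
    fix w assume "w \<in> star"
    then obtain j e u where u: "u \<in> piece" "w = dih j e u" by (auto simp: star_iff)
    have cl: "closed (dih j e -` closure image_F)"
      by (intro closed_vimage continuous_on_dih continuous_on_id closed_closure)
    have "interior piece \<subseteq> dih j e -` closure image_F"
    proof
      fix v assume "v \<in> interior piece"
      then obtain z where z: "z \<in> interior sector" "v = G z" using interior_piece_subset by auto
      then have "z \<in> sector" "z \<notin> of_real ` {1..}" using interior_subset[of sector] by (blast, auto simp: interior_sector)
      then have "dih j e v \<in> image_F" using z by (auto simp: image_F_iff)
      then show "v \<in> dih j e -` closure image_F" using closure_subset by auto
    qed
    then have "closure (interior piece) \<subseteq> dih j e -` closure image_F" using cl by (rule closure_minimal)
    then show "w \<in> closure image_F" using u closure_interior_piece by auto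
  qed
qed

lemma frontier_image_F: "frontier image_F = star - image_F"
  by (simp add: frontier_def closure_image_F interior_open open_image_F)

end

section \<open>The polygons\<close>

lemma ht_zero_imp:
  assumes "ht \<theta> w = 0"
  obtains t where "w = of_real t * cis \<theta>" 
proof
  have "w * cis (- \<theta>) = of_real (Re (w * cis (- \<theta>)))"
    using assms by (simp add: complex_eq_iff ht_def)
  then have "of_real (Re (w * cis (- \<theta>))) * cis \<theta> = w * (cis (- \<theta>) * cis \<theta>)" by (simp add: mult.assoc)
  also have "\<dots> = w" unfolding cis_mult by simp
  finally show "w = of_real (Re (w * cis (- \<theta>))) * cis \<theta>" by simp
qed

context sc_map
begin

text \<open>The reflection in the bisector of the angle AOB: it swaps A and B and fixes P.\<close>

abbreviation refl :: "complex \<Rightarrow> complex" where "refl \<equiv> dih 1 True"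

lemma refl_refl [simp]: "refl (refl w) = w"
  by (simp add: dih_dih)

lemma ht_refl: "ht \<theta> (refl w) = - ht (2 * a - \<theta>) w"
proof -
  have "refl w * cis (- \<theta>) = cis (2 * a - \<theta>) * cnj w"
    unfolding dih_def by (simp add: cis_mult[symmetric] algebra_simps cis_divide[symmetric] divide_inverse)
  also have "\<dots> = cnj (w * cis (- (2 * a - \<theta>)))" by (simp add: cis_cnj)
  finally show ?thesis by (simp add: ht_def)
qed

lemma refl_on_axis: "ht a w = 0 \<Longrightarrow> refl w = w"
  by (erule ht_zero_imp) (simp add: dih_def cis_cnj cis_mult mult.left_commute[of "cis _"])

lemma linear_refl: "linear refl"
  by (rule linearI) (simp_all add: dih_def scaleR_conv_of_real algebra_simps)

lemma refl_A: "refl (pt_A n k) = pt_B n k"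
  by (simp add: pt_A_def pt_B_def omega_eq dih_def mult.commute)

text \<open>The edge on the bisector is left out: it becomes interior, apart from its endpoints,
  when the piece is doubled by \<open>refl\<close>.\<close>

definition piece_boundary :: "complex set" where
  "piece_boundary = {w \<in> piece. Im w = 0 \<or> ht (real k * a) (w - of_real (phi n k)) = 0}"

lemma A_piece: "of_real (phi n k) \<in> piece"
  using phi_pos sin_a_pos by (simp add: piece_def)

lemma zero_piece: "0 \<in> piece"
  using phi_pos sin_ka_pos by (simp add: piece_def ht_diff)

lemma piece_boundary_bottom: "{w \<in> piece. Im w = 0} = closed_segment 0 (pt_A n k)"
proof
  show "{w \<in> piece. Im w = 0} \<subseteq> closed_segment 0 (pt_A n k)"
  proof
    fix w assume w: "w \<in> {w \<in> piece. Im w = 0}"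
    then have wr: "w = of_real (Re w)" "0 \<le> Re w" using sector_line0[of w] piece_subset_sector by blast+
    have "0 \<le> ht (real k * a) (of_real (Re w) - of_real (phi n k))" using w wr(1) by (simp add: piece_def)
    then have "0 \<le> (phi n k - Re w) * sin (real k * a)" by (simp add: ht_diff algebra_simps)
    then have "Re w \<le> phi n k" using sin_ka_pos by (simp add: zero_le_mult_iff)
    then have "w = (1 - Re w / phi n k) *\<^sub>R 0 + (Re w / phi n k) *\<^sub>R pt_A n k"
      using phi_pos wr by (simp add: pt_A_def scaleR_conv_of_real)
    moreover have "0 \<le> Re w / phi n k" "Re w / phi n k \<le> 1" using \<open>Re w \<le> phi n k\<close> wr phi_pos by auto
    ultimately show "w \<in> closed_segment 0 (pt_A n k)" unfolding in_segment by blast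
  qed
  show "closed_segment 0 (pt_A n k) \<subseteq> {w \<in> piece. Im w = 0}"
  proof
    fix w assume w: "w \<in> closed_segment 0 (pt_A n k)"
    then have "w \<in> piece" using convex_piece zero_piece A_piece by (auto simp: convex_contains_segment pt_A_def)
    moreover have "Im w = 0" using w by (auto simp: in_segment pt_A_def)
    ultimately show "w \<in> {w \<in> piece. Im w = 0}" by simp
  qed
qed

lemma piece_boundary_outer_param:
  assumes "w \<in> piece" "ht (real k * a) (w - of_real (phi n k)) = 0"
  obtains t where "0 \<le> t" "w = of_real (phi n k) + of_real t * cis (real k * a)" 
    "t * sin (real k * a - a) \<le> phi n k * sin a"
proof -
  obtain t where t: "w - of_real (phi n k) = of_real t * cis (real k * a)" using ht_zero_imp[OF assms(2)] by blast
  then have w: "w = of_real (phi n k) + of_real t * cis (real k * a)" by (simp add: algebra_simps)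
  have "0 \<le> t * sin (real k * a)" using assms(1) by (simp add: piece_def w)
  then have "0 \<le> t" using sin_ka_pos by (simp add: zero_le_mult_iff)
  moreover have "ht a w \<le> 0" using assms(1) by (simp add: piece_def)
  then have "t * sin (real k * a - a) \<le> phi n k * sin a" unfolding w ht_add ht_rcis by simp
  ultimately show ?thesis using that w by blast
qed

lemma P_piece: assumes "k > 1" shows "pt_P n k \<in> piece"
proof -
  have L: "0 \<le> L" using phi_pos sin_a_pos sin_k1a_pos[OF assms] by (simp add: L_def)
  then have "0 \<le> Im (pt_P n k)" "ht (real k * a) (pt_P n k - of_real (phi n k)) = 0"
    unfolding pt_P_eq[OF assms] using sin_ka_pos by (auto simp: ht_rcis)
  then show ?thesis using ht_pt_P[OF assms] by (simp add: piece_def)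
qed

lemma piece_boundary_outer_gt1:
  assumes "k > 1"
  shows "{w \<in> piece. ht (real k * a) (w - of_real (phi n k)) = 0} = closed_segment (pt_A n k) (pt_P n k)"
proof
  have L: "0 < L" using phi_pos sin_a_pos sin_k1a_pos[OF assms] by (simp add: L_def)
  show "{w \<in> piece. ht (real k * a) (w - of_real (phi n k)) = 0} \<subseteq> closed_segment (pt_A n k) (pt_P n k)"
  proof
    fix w assume "w \<in> {w \<in> piece. ht (real k * a) (w - of_real (phi n k)) = 0}"
    then obtain t where t: "0 \<le> t" "w = of_real (phi n k) + of_real t * cis (real k * a)" 
        "t * sin (real k * a - a) \<le> phi n k * sin a"
      using piece_boundary_outer_param by blast
    then have "t \<le> L" using sin_k1a_pos[OF assms] by (simp add: L_def pos_le_divide_eq)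
    have "w = (1 - t / L) *\<^sub>R pt_A n k + (t / L) *\<^sub>R pt_P n k"
      unfolding t(2) pt_P_eq[OF assms] pt_A_def using L by (simp add: scaleR_conv_of_real algebra_simps)
    moreover have "0 \<le> t / L" "t / L \<le> 1" using t L \<open>t \<le> L\<close> by auto
    ultimately show "w \<in> closed_segment (pt_A n k) (pt_P n k)" unfolding in_segment by blast
  qed
  show "closed_segment (pt_A n k) (pt_P n k) \<subseteq> {w \<in> piece. ht (real k * a) (w - of_real (phi n k)) = 0}"
  proof
    fix w assume w: "w \<in> closed_segment (pt_A n k) (pt_P n k)"
    then have "w \<in> piece" using convex_piece P_piece[OF assms] A_piece by (auto simp: convex_contains_segment pt_A_def)
    obtain u where "w = (1 - u) *\<^sub>R pt_A n k + u *\<^sub>R pt_P n k" using w by (auto simp: in_segment)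
    then have "w - of_real (phi n k) = of_real (u * L) * cis (real k * a)"
      unfolding pt_P_eq[OF assms] pt_A_def by (simp add: scaleR_conv_of_real algebra_simps)
    then have "ht (real k * a) (w - of_real (phi n k)) = 0" by (simp only: ht_rcis) simp
    then show "w \<in> {w \<in> piece. ht (real k * a) (w - of_real (phi n k)) = 0}" using \<open>w \<in> piece\<close> by simp
  qed
qed

lemma piece_boundary_outer_eq1:
  assumes "k = 1"
  shows "{w \<in> piece. ht (real k * a) (w - of_real (phi n k)) = 0} = ray (pt_A n k) (cis (pi / real n))"
proof
  show "{w \<in> piece. ht (real k * a) (w - of_real (phi n k)) = 0} \<subseteq> ray (pt_A n k) (cis (pi / real n))"
  proof
    fix w assume "w \<in> {w \<in> piece. ht (real k * a) (w - of_real (phi n k)) = 0}"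
    then obtain t where "0 \<le> t" "w = of_real (phi n k) + of_real t * cis (real k * a)" 
      using piece_boundary_outer_param by blast
    then show "w \<in> ray (pt_A n k) (cis (pi / real n))"
      using assms unfolding ray_def pt_A_def by (auto simp: a_def)
  qed
  show "ray (pt_A n k) (cis (pi / real n)) \<subseteq> {w \<in> piece. ht (real k * a) (w - of_real (phi n k)) = 0}"
  proof
    fix w assume "w \<in> ray (pt_A n k) (cis (pi / real n))"
    then obtain t where t: "0 \<le> t" "w = of_real (phi n k) + of_real t * cis a"
      by (auto simp: ray_def pt_A_def a_def)
    have ka: "real k * a = a" using assms by simp
    show "w \<in> {w \<in> piece. ht (real k * a) (w - of_real (phi n k)) = 0}"
      unfolding piece_def ka using t phi_pos sin_a_pos by (simp add: ht_add ht_rcis)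
  qed
qed

lemma Pi_boundary_eq: "Pi_boundary n k = piece_boundary \<union> refl ` piece_boundary"
proof -
  have piece_boundary: "piece_boundary = {w \<in> piece. Im w = 0} \<union> {w \<in> piece. ht (real k * a) (w - of_real (phi n k)) = 0}"
    by (auto simp: piece_boundary_def)
  show ?thesis
  proof (cases "k = 1")
    case True
    have "refl ` ray (pt_A n k) (cis a) = ray (pt_B n k) (cis a)"
    proof -
      have "refl (pt_A n k + of_real t * cis a) = pt_B n k + of_real t * cis a" for t
        unfolding dih_add refl_A by (simp add: refl_on_axis ht_rcis)
      then show ?thesis by (force simp: ray_def image_iff)
    qed
    moreover have "refl ` closed_segment 0 (pt_A n k) = closed_segment 0 (pt_B n k)"
      using closed_segment_linear_image[OF linear_refl, of 0 "pt_A n k"] by (simp add: refl_A)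
    ultimately show ?thesis
      unfolding piece_boundary piece_boundary_bottom piece_boundary_outer_eq1[OF True] image_Un a_def[symmetric] Pi_boundary_def using True by auto
  next
    case False
    then have k: "k > 1" using k1 by simp
    have "refl ` closed_segment (pt_A n k) (pt_P n k) = closed_segment (pt_P n k) (pt_B n k)"
      using closed_segment_linear_image[OF linear_refl, of "pt_A n k" "pt_P n k"]
        refl_on_axis[OF ht_pt_P[OF k]] by (simp add: refl_A closed_segment_commute)
    moreover have "refl ` closed_segment 0 (pt_A n k) = closed_segment (pt_B n k) 0"
      using closed_segment_linear_image[OF linear_refl, of 0 "pt_A n k"] by (simp add: refl_A closed_segment_commute)
    ultimately show ?thesis
      unfolding piece_boundary piece_boundary_bottom piece_boundary_outer_gt1[OF k] image_Un Pi_boundary_def using False by auto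
  qed
qed

section \<open>The region enclosed by the polygon\<close>

definition Pi0 :: "complex set" where "Pi0 = piece \<union> refl ` piece"

lemma Pi0_refl: "refl w \<in> Pi0 \<longleftrightarrow> w \<in> Pi0"
  by (auto simp: Pi0_def image_iff) (metis refl_refl)+

lemma boundary_Pi0: "Pi_boundary n k \<subseteq> Pi0"
  unfolding Pi_boundary_eq Pi0_def by (auto simp: piece_boundary_def)

lemma closed_Pi0: "closed Pi0"
  unfolding Pi0_def by (intro closed_Un closed_piece closed_dih)

lemma piece_minus_piece_boundary:
  "w \<in> piece \<Longrightarrow> w \<notin> piece_boundary \<Longrightarrow> 0 < Im w \<and> 0 < ht (real k * a) (w - of_real (phi n k)) \<and> ht a w \<le> 0"
  by (auto simp: piece_boundary_def piece_def)

lemma Pi0_interior: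
  assumes "w \<in> Pi0" "w \<notin> Pi_boundary n k" shows "w \<in> interior Pi0"
proof -
  have open_half: "open {v. 0 < Im v \<and> 0 < ht (real k * a) (v - of_real (phi n k))}"
    by (intro open_Collect_conj open_Collect_less continuous_intros)
  have main: "\<exists>S. open S \<and> u \<in> S \<and> S \<subseteq> Pi0" if u: "u \<in> piece" "u \<notin> piece_boundary" for u
  proof (cases "ht a u = 0")
    case False
    let ?S = "{v. 0 < Im v \<and> 0 < ht (real k * a) (v - of_real (phi n k))} \<inter> {v. ht a v < 0}"
    have "open ?S" by (intro open_Int open_half open_Collect_less continuous_intros)
    moreover have "u \<in> ?S" using piece_minus_piece_boundary[OF u] False by simp
    moreover have "?S \<subseteq> Pi0" by (auto simp: Pi0_def piece_def)
    ultimately show ?thesis by blast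
  next
    case True
    \<comment> \<open>On the bisector the neighbourhood is intersected with its mirror image, so
      that each of its points, or the reflection of that point, lies in
      \<open>piece\<close>.\<close>
    let ?N = "{v. 0 < Im v \<and> 0 < ht (real k * a) (v - of_real (phi n k))}"
    have "open (?N \<inter> refl -` ?N)"
      by (intro open_Int open_half open_vimage continuous_on_dih continuous_on_id)
    moreover have "u \<in> ?N \<inter> refl -` ?N" using piece_minus_piece_boundary[OF u] refl_on_axis[OF True] by simp
    moreover have "?N \<inter> refl -` ?N \<subseteq> Pi0"
    proof
      fix v assume v: "v \<in> ?N \<inter> refl -` ?N"
      show "v \<in> Pi0"
      proof (cases "ht a v \<le> 0")
        case True
        then show ?thesis using v by (auto simp: Pi0_def piece_def)
      next
        case False
        then have "ht a (refl v) \<le> 0" by (simp add: ht_refl)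
        then have "refl v \<in> Pi0" using v by (auto simp: Pi0_def piece_def)
        then show ?thesis by (simp add: Pi0_refl)
      qed
    qed
    ultimately show ?thesis by blast
  qed
  have "w \<in> piece \<and> w \<notin> piece_boundary \<or> refl w \<in> piece \<and> refl w \<notin> piece_boundary"
    using assms unfolding Pi0_def Pi_boundary_eq by (auto simp: image_iff)
  then show ?thesis
  proof
    assume "w \<in> piece \<and> w \<notin> piece_boundary"
    then show ?thesis using main[of w] by (auto simp: interior_def)
  next
    assume "refl w \<in> piece \<and> refl w \<notin> piece_boundary"
    then obtain S where S: "open S" "refl w \<in> S" "S \<subseteq> Pi0" using main[of "refl w"] by blast
    have "open (refl -` S)" by (intro open_vimage continuous_on_dih continuous_on_id S)
    moreover have "refl -` S \<subseteq> Pi0" using S(3) Pi0_refl by blast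
    ultimately show ?thesis using S(2) by (auto simp: interior_def)
  qed
qed

text \<open>The closed set \<open>Pi0\<close> has its frontier in the polygonal boundary, so a
  connected set avoiding that boundary cannot leave it; this takes the place of the Jordan curve
  theorem.\<close>

lemma component_subset_Pi0:
  assumes "w \<in> Pi0" shows "connected_component_set (- Pi_boundary n k) w \<subseteq> Pi0"
proof (cases "w \<in> Pi_boundary n k")
  case True
  then have "connected_component_set (- Pi_boundary n k) w = {}"
    using connected_component_eq_empty[of "- Pi_boundary n k" w] by blast
  then show ?thesis by (simp only: empty_subsetI)
next
  case False
  let ?C = "connected_component_set (- Pi_boundary n k) w"
  show ?thesis
  proof (rule ccontr)
    assume "\<not> ?C \<subseteq> Pi0"
    then have "?C - Pi0 \<noteq> {}" by blast
    moreover have "w \<in> ?C" using False by simp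
    then have "?C \<inter> Pi0 \<noteq> {}" using assms by blast
    ultimately have "?C \<inter> frontier Pi0 \<noteq> {}"
      by (intro connected_Int_frontier connected_connected_component)
    then obtain v where v: "v \<in> ?C" "v \<in> frontier Pi0" by blast
    then have "v \<in> Pi0" "v \<notin> interior Pi0" using closed_Pi0 by (auto simp: frontier_def)
    then have "v \<in> Pi_boundary n k" using Pi0_interior by blast
    then show False using v(1) connected_component_subset by blast
  qed
qed

lemma Pi0_scale:
  assumes "w \<in> Pi0" "0 \<le> t" "t \<le> 1" shows "of_real t * w \<in> Pi0"
proof -
  have D: "of_real t * u \<in> piece" if "u \<in> piece" for u
    using convexD_alt[OF convex_piece zero_piece that, of t] assms by (simp add: scaleR_conv_of_real)
  have "refl (of_real t * u) = of_real t * refl u" for u by (simp add: dih_def)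
  then show ?thesis using assms(1) D unfolding Pi0_def by (auto simp: image_iff) metis
qed

lemma bounded_piece: assumes "k > 1" shows "bounded piece"
proof -
  have "norm w \<le> phi n k + phi n k * sin a / sin (real k * a - a)" if w: "w \<in> piece" for w
  proof -
    \<comment> \<open>Oblique coordinates along 1 and \<open>cis (real k * a)\<close>: the outer
      line bounds \<open>x\<close> by \<open>phi n k\<close>, and the bisector bounds
      \<open>y\<close> in terms of \<open>x\<close>.\<close>
    define y where "y = Im w / sin (real k * a)"
    define x where "x = Re w - y * cos (real k * a)"
    have y: "0 \<le> y" using w sin_ka_pos by (simp add: y_def piece_def)
    have wxy: "w = of_real x + of_real y * cis (real k * a)"
      using sin_ka_pos by (simp add: complex_eq_iff x_def y_def)
    have "0 \<le> ht (real k * a) (w - of_real (phi n k))" using w by (simp add: piece_def)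
    then have "0 \<le> (phi n k - x) * sin (real k * a)"
      unfolding wxy ht_diff ht_add ht_rcis by (simp add: algebra_simps)
    then have x: "x \<le> phi n k" using sin_ka_pos by (simp add: zero_le_mult_iff)
    have "ht a w \<le> 0" using w by (simp add: piece_def)
    then have xy: "y * sin (real k * a - a) \<le> x * sin a" unfolding wxy ht_add ht_rcis by simp
    moreover have "0 \<le> y * sin (real k * a - a)" using y sin_k1a_pos[OF assms] by simp
    ultimately have "0 \<le> x * sin a" by linarith
    then have x0: "0 \<le> x" using sin_a_pos by (simp add: zero_le_mult_iff)
    have "y * sin (real k * a - a) \<le> phi n k * sin a"
      using xy mult_right_mono[OF x, of "sin a"] sin_a_pos by linarith
    then have "y \<le> phi n k * sin a / sin (real k * a - a)"
      using sin_k1a_pos[OF assms] by (simp add: pos_le_divide_eq)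
    moreover have "norm w \<le> x + y"
      unfolding wxy using norm_triangle_ineq[of "of_real x" "of_real y * cis (real k * a)"] x0 y
      by (simp add: norm_mult)
    ultimately show ?thesis using x by linarith
  qed
  then show ?thesis by (auto simp: bounded_iff)
qed

lemma inside_eq: assumes "k > 1" shows "inside (Pi_boundary n k) = Pi0 - Pi_boundary n k"
proof
  show "inside (Pi_boundary n k) \<subseteq> Pi0 - Pi_boundary n k"
  proof
    fix w assume w: "w \<in> inside (Pi_boundary n k)"
    then have wB: "w \<notin> Pi_boundary n k" and bd: "bounded (connected_component_set (- Pi_boundary n k) w)"
      by (auto simp: inside_def)
    have "w \<in> Pi0"
    proof (rule ccontr)
      assume n: "w \<notin> Pi0"
      \<comment> \<open>As \<open>Pi0\<close> is star-shaped about 0, the ray from \<open>w\<close>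
        away from 0 never meets it, so the component of \<open>w\<close> would be unbounded.\<close>
      define R where "R = (\<lambda>t. of_real t * w) ` {1..}"
      have "R \<inter> Pi0 = {}"
      proof -
        have "of_real t * w \<notin> Pi0" if "1 \<le> t" for t
        proof
          assume "of_real t * w \<in> Pi0"
          then have "of_real (1 / t) * (of_real t * w) \<in> Pi0" by (rule Pi0_scale) (use that in auto)
          moreover have "of_real (1 / t) * (of_real t * w) = w" using that by simp
          ultimately show False using n by (simp only:)
        qed
        then show ?thesis by (auto simp: R_def)
      qed
      then have "R \<subseteq> - Pi_boundary n k" using boundary_Pi0 by blast
      moreover have "connected R" unfolding R_def
        by (intro connected_continuous_image continuous_intros) (simp add: is_interval_connected)
      moreover have "w \<in> R" unfolding R_def by (rule image_eqI[of _ _ 1]) auto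
      ultimately have "R \<subseteq> connected_component_set (- Pi_boundary n k) w"
        by (intro connected_component_maximal)
      then have "bounded R" using bd bounded_subset by blast
      then obtain M where M: "\<And>v. v \<in> R \<Longrightarrow> norm v \<le> M" by (auto simp: bounded_iff)
      have "0 \<in> Pi0" using zero_piece by (simp add: Pi0_def)
      then have w0: "0 < norm w" using n by auto
      define t where "t = 1 + \<bar>M\<bar> / norm w"
      have "1 \<le> t" using w0 by (simp add: t_def)
      then have "norm (of_real t * w) \<le> M" using M by (auto simp: R_def)
      then have "t * norm w \<le> M" using \<open>1 \<le> t\<close> by (simp add: norm_mult)
      moreover have "t * norm w = norm w + \<bar>M\<bar>" using w0 by (simp add: t_def field_simps)
      ultimately show False using w0 abs_ge_self[of M] by linarith
    qed
    then show "w \<in> Pi0 - Pi_boundary n k" using wB by simp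
  qed
  have "bounded Pi0"
  proof -
    have "norm w \<le> M" if "\<And>v. v \<in> piece \<Longrightarrow> norm v \<le> M" "w \<in> Pi0" for w M
      using that by (auto simp: Pi0_def)
    then show ?thesis using bounded_piece[OF assms] unfolding bounded_iff by metis
  qed
  then have "bounded (connected_component_set (- Pi_boundary n k) w)" if "w \<in> Pi0" for w
    using bounded_subset component_subset_Pi0[OF that] by metis
  then show "Pi0 - Pi_boundary n k \<subseteq> inside (Pi_boundary n k)"
    by (auto simp: inside_def)
qed

lemma component_eq: 
  assumes "k = 1"
  shows "connected_component_set (- Pi_boundary n k) (cis a) = Pi0 - Pi_boundary n k"
proof
  have ka: "real k * a = a" using assms by simp
  define c where "c = phi n k * sin a"
  have c: "0 < c" using phi_pos sin_a_pos by (simp add: c_def)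
  \<comment> \<open>A convex set that avoids the boundary: the open angle AOB cut down to the strip
    of half-width \<open>c\<close> about the bisector, \<open>c\<close> being the distance of the
    two parallel rays from it.\<close>
  define W where "W = {w. 0 < ht 0 w} \<inter> {w. ht (2 * a) w < 0} \<inter> {w. - c < ht a w} \<inter> {w. ht a w < c}"
  have W_refl: "refl w \<in> W" if "w \<in> W" for w using that by (simp add: W_def ht_refl)
  have W_B: "W \<inter> Pi_boundary n k = {}"
  proof -
    have "w \<notin> W" if "w \<in> piece_boundary" for w
      using that unfolding piece_boundary_def ka by (auto simp: W_def Im_eq_ht ht_diff c_def)
    then show ?thesis using W_refl unfolding Pi_boundary_eq by (auto simp: image_iff) (metis refl_refl)
  qed
  have sub: "Pi0 - Pi_boundary n k \<subseteq> W"
  proof -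
    have D: "w \<in> W" if w: "w \<in> piece" "w \<notin> piece_boundary" for w
    proof -
      obtain r s where rs: "w = of_real r * cis s" "norm w = r" "0 \<le> s" "s \<le> a"
        using w piece_subset_sector sector_polar by blast
      have *: "0 < Im w" "0 < ht a (w - of_real (phi n k))" "ht a w \<le> 0" using piece_minus_piece_boundary[OF w] ka by auto
      have "0 < norm w" using * by auto
      moreover have "0 < sin (2 * a - s)" using rs a_pos a_lt_pi2 by (intro sin_gt_zero) auto
      moreover have "ht (2 * a) w = - (norm w * sin (2 * a - s))"
      proof -
        have "ht (2 * a) w = r * sin (s - 2 * a)" unfolding rs(1) by (rule ht_rcis)
        also have "sin (s - 2 * a) = - sin (2 * a - s)" using sin_minus[of "2 * a - s"] by simp
        finally show ?thesis using rs(2) by simp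
      qed
      ultimately show ?thesis using * c by (simp add: W_def Im_eq_ht ht_diff c_def)
    qed
    show ?thesis
    proof
      fix w assume "w \<in> Pi0 - Pi_boundary n k"
      then have "w \<in> piece \<and> w \<notin> piece_boundary \<or> (\<exists>u. w = refl u \<and> u \<in> piece \<and> u \<notin> piece_boundary)"
        unfolding Pi0_def Pi_boundary_eq by auto
      then show "w \<in> W" using D W_refl by auto
    qed
  qed
  have cW: "cis a \<in> W" using sin_a_pos c by (simp add: W_def)
  have "connected W" unfolding W_def ht_inner
    by (intro convex_connected convex_Int convex_halfspace_gt convex_halfspace_lt)
  then have "W \<subseteq> connected_component_set (- Pi_boundary n k) (cis a)"
    using cW W_B by (intro connected_component_maximal) auto
  then show "Pi0 - Pi_boundary n k \<subseteq> connected_component_set (- Pi_boundary n k) (cis a)" using sub by blast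
  have "cis a \<in> Pi0" using sin_a_pos phi_pos by (simp add: Pi0_def piece_def ka ht_diff)
  then show "connected_component_set (- Pi_boundary n k) (cis a) \<subseteq> Pi0 - Pi_boundary n k"
    using component_subset_Pi0 connected_component_subset by blast
qed

lemma Pi_set_eq: "Pi_set n k = Pi0"
  unfolding Pi_set_def using inside_eq component_eq boundary_Pi0 k1
  by (cases "k = 1") (auto simp: a_def)

text \<open>Since \<open>Pi0\<close> contains a piece and its mirror image, rotations alone produce
  all dihedral copies; the shift \<open>j - 1\<close> accounts for the rotation contained in
  \<open>refl\<close>.\<close>

lemma rotations_Pi_set: "rotations n (Pi_set n k) = star"
proof -
  have "(\<exists>j. \<exists>z\<in>Pi0. w = dih j False z) \<longleftrightarrow> (\<exists>j e. \<exists>z\<in>piece. w = dih j e z)" for w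
  proof
    assume "\<exists>j. \<exists>z\<in>Pi0. w = dih j False z"
    then obtain j z where "z \<in> Pi0" "w = dih j False z" by blast
    then show "\<exists>j e. \<exists>z\<in>piece. w = dih j e z" unfolding Pi0_def using dih_dih[of j False 1 True] by auto
  next
    assume "\<exists>j e. \<exists>z\<in>piece. w = dih j e z"
    then obtain j e z where z: "z \<in> piece" "w = dih j e z" by blast
    then have "w = dih (if e then j - 1 else j) False (if e then refl z else z)" by (simp add: dih_dih)
    moreover have "(if e then refl z else z) \<in> Pi0" using z by (auto simp: Pi0_def)
    ultimately show "\<exists>j. \<exists>z\<in>Pi0. w = dih j False z" by blast
  qed
  then show ?thesis unfolding Pi_set_eq by (auto simp: rotations_iff star_iff)
qed

lemma Omega_eq: "Omega n k = image_F"
  unfolding Omega_def rotations_Pi_set by (rule interior_star)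

section \<open>Boundary values and maximality\<close>

lemma image_F_I: "\<lbrakk>z \<in> sector; z \<notin> of_real ` {1..}\<rbrakk> \<Longrightarrow> dih j e (G z) \<in> image_F"
  unfolding image_F_iff by blast

lemma rotations_I: "z \<in> Y \<Longrightarrow> dih j False z \<in> rotations n Y"
  unfolding rotations_iff by blast

text \<open>Surjectivity is read off from \<open>G_inv\<close>: the preimage of a real value lies on
  the real edge, and not beyond 1, because the slit is mapped above the axis.\<close>

lemma unit_preimage:
  assumes "0 \<le> x" "x < phi n k"
  obtains s where "0 \<le> s" "s < 1" "G (of_real s) = of_real x"
proof -
  have "of_real x = (1 - x / phi n k) *\<^sub>R 0 + (x / phi n k) *\<^sub>R pt_A n k"
    using phi_pos by (simp add: pt_A_def scaleR_conv_of_real)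
  moreover have "0 \<le> x / phi n k" "x / phi n k \<le> 1" using assms by auto
  ultimately have "of_real x \<in> closed_segment 0 (pt_A n k)" unfolding in_segment by blast
  then have xD: "of_real x \<in> piece" using piece_boundary_bottom by blast
  have "k = 1 \<or> of_real x \<noteq> pt_P n k"
  proof (cases "k = 1")
    case False
    then have k: "k > 1" using k1 by simp
    have "0 < L" using phi_pos sin_a_pos sin_k1a_pos[OF k] by (simp add: L_def)
    then have "0 < Im (pt_P n k)" unfolding pt_P_eq[OF k] using sin_ka_pos by simp
    then show ?thesis by (metis Im_complex_of_real less_irrefl)
  qed simp
  then have xD': "of_real x \<in> piece'" using xD by (simp add: piece'_def)
  define z where "z = G_inv (of_real x)"
  have z: "z \<in> sector" "G z = of_real x" using G_inv_sector[OF xD'] G_G_inv[OF xD'] by (auto simp: z_def)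
  then have "Im z = 0" "z \<notin> of_real ` {1<..}" using G_Im_zero[of z] by auto
  then have s: "z = of_real (Re z)" "0 \<le> Re z" using sector_line0 z by blast+
  have "Re z \<noteq> 1" using s z G_1 assms by auto
  moreover have "\<not> Re z > 1" using s \<open>z \<notin> of_real ` {1<..}\<close> by (metis greaterThan_iff imageI)
  ultimately show ?thesis using that[of "Re z"] s z by auto
qed

lemma S_inv_eq:
  assumes "0 \<le> s" "s \<le> 1" "G (of_real s) = of_real x" shows "S_inv n k x = s"
  unfolding S_inv_def
proof (rule inv_into_f_eq)
  show "inj_on (F_int n k) {0..1}"
  proof (rule inj_onI)
    fix u v assume "u \<in> {0..1}" "v \<in> {0..1}" "F_int n k u = F_int n k v"
    then have "of_real u \<in> sector" "of_real v \<in> sector" "G (of_real u) = G (of_real v)"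
      by (auto simp: G_unit_F_int)
    then have "(of_real u :: complex) = of_real v" using inj_onD[OF G_inj] by blast
    then show "u = v" by simp
  qed
  show "F_int n k s = x" using G_unit_F_int[of s] assms by simp
qed (use assms in auto)

lemma S_ext_continues: "continues_S n k image_F S_ext"
proof -
  have *: "of_real x \<in> image_F \<and> S_ext (of_real x) = of_real (S_inv n k x)" if x: "0 \<le> x" "x < phi n k" for x
  proof -
    obtain s where s: "0 \<le> s" "s < 1" "G (of_real s) = of_real x" using unit_preimage[OF x] .
    have "of_real s \<in> sector" "of_real s \<notin> (of_real ` {1..} :: complex set)" using s by auto
    then have "of_real x \<in> image_F" "S_ext (of_real x) = of_real s"
      using S_ext_dih[of "of_real s" 0 False] image_F_I[of "of_real s" 0 False] s by simp_all
    then show ?thesis using S_inv_eq[of s x] s by simp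
  qed
  then show ?thesis
    unfolding continues_S_def using open_image_F connected_image_F S_ext_biholo
    by (auto simp: biholomorphism_def)
qed

definition outer_edges :: "complex set" where
  "outer_edges = {w. \<exists>j e x. 1 < x \<and> w = dih j e (G (of_real x))}"

lemma outer_edges_I: "1 < x \<Longrightarrow> dih j e (G (of_real x)) \<in> outer_edges"
  unfolding outer_edges_def by blast

text \<open>A point on a mirror has only rotated copies. Hence removing the rotations of A and P
  removes all their dihedral copies.\<close>

lemma dih_False: assumes "refl u = u \<or> cnj u = u" obtains i where "dih j e u = dih i False u"
proof (cases e)
  case True
  show ?thesis
  proof (cases "cnj u = u")
    case True
    then show ?thesis using that[of j] by (simp add: dih_def)
  next
    case False
    then have "dih j True u = dih (j - 1) False u" 
      using assms dih_dih[of "j - 1" False 1 True u] by simp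
    then show ?thesis using that True by simp
  qed
qed (use that in simp)

lemma frontier_outer_edges:
  assumes Q: "Q = (if k = 1 then {of_real (phi n k)} else {of_real (phi n k), pt_P n k})"
  shows "frontier image_F - rotations n Q = outer_edges"
proof
  show "frontier image_F - rotations n Q \<subseteq> outer_edges"
  proof
    fix w assume w: "w \<in> frontier image_F - rotations n Q"
    then obtain j e u where u: "u \<in> piece" "w = dih j e u" "w \<notin> image_F" by (auto simp: frontier_image_F star_iff)
    from u(1) show "w \<in> outer_edges"
    proof (cases rule: piece_cases)
      case (1 z)
      then show ?thesis using u image_F_I[of z j e] by simp
    next
      case (2 x)
      have "x \<noteq> 1"
      proof
        assume "x = 1"
        then have "u = of_real (phi n k)" using 2 G_1 by simp
        moreover obtain i where "dih j e u = dih i False u" using dih_False[of u j e] calculation by auto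
        ultimately have "w \<in> rotations n Q" using u(2) Q rotations_I[of u Q i] by simp
        then show False using w by simp
      qed
      then show ?thesis using 2 u outer_edges_I[of x j e] by simp
    next
      case 3
      obtain i where "dih j e u = dih i False u" 
        using dih_False[of u j e] refl_on_axis[OF ht_pt_P] 3 by auto
      then have "w \<in> rotations n Q" using u(2) Q 3 rotations_I[of u Q i] by simp
      then show ?thesis using w by simp
    qed
  qed
  show "outer_edges \<subseteq> frontier image_F - rotations n Q"
  proof
    fix w assume "w \<in> outer_edges"
    then obtain j e x where x: "1 < x" "w = dih j e (G (of_real x))" by (auto simp: outer_edges_def)
    have GD: "G (of_real x) \<in> piece" using x by (intro G_in_piece) simp
    then have "w \<in> star" using x by (auto simp: star_iff)
    moreover have "w \<notin> image_F" using slit_not_interior x interior_star by metis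
    moreover have "w \<notin> rotations n Q"
    proof
      assume "w \<in> rotations n Q"
      then obtain i v where v: "v \<in> Q" "dih j e (G (of_real x)) = dih i False v" using x by (auto simp: rotations_iff)
      then have vc: "v = of_real (phi n k) \<or> k > 1 \<and> v = pt_P n k" using Q k1 by (auto split: if_splits)
      then have "v \<in> piece" using A_piece P_piece by auto
      then have "v = G (of_real x)" using dih_eq(1)[OF _ _ v(2)] GD piece_subset_sector by auto
      then show False using vc G_slit_Im[OF x(1)] G_slit_ht[of x] x ht_pt_P by auto
    qed
    ultimately show "w \<in> frontier image_F - rotations n Q" by (simp add: frontier_image_F)
  qed
qed

lemma dih_slit_value: "1 < x \<Longrightarrow> S_ext (dih j e (G (of_real x))) = dih j False (of_real x)"
  using S_ext_dih[of "of_real x" j e] dih_of_real[of j e x] by simp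

text \<open>Over one slit point lie the rotated and the reflected copy with the same index, coming
  from the two sides of the slit; they differ because \<open>G\<close> has positive imaginary part
  beyond 1.\<close>

lemma S_ext_two_to_one: "two_to_one_onto S_ext outer_edges (rotations n (of_real ` {1<..}))"
  unfolding two_to_one_onto_def
proof (intro conjI ballI)
  show "S_ext ` outer_edges = rotations n (of_real ` {1<..})"
  proof
    show "S_ext ` outer_edges \<subseteq> rotations n (of_real ` {1<..})"
      by (auto simp: outer_edges_def dih_slit_value intro!: rotations_I)
    show "rotations n (of_real ` {1<..}) \<subseteq> S_ext ` outer_edges"
    proof
      fix y assume "y \<in> rotations n (of_real ` {1<..})"
      then obtain j x where x: "1 < x" "y = dih j False (of_real x)" by (auto simp: rotations_iff)
      then have "y = S_ext (dih j False (G (of_real x)))" by (simp add: dih_slit_value)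
      moreover have "dih j False (G (of_real x)) \<in> outer_edges" using x(1) by (rule outer_edges_I)
      ultimately show "y \<in> S_ext ` outer_edges" by blast
    qed
  qed
  fix y assume "y \<in> rotations n (of_real ` {1<..})"
  then obtain j x where x: "1 < x" "y = dih j False (of_real x)" by (auto simp: rotations_iff)
  have "{w \<in> outer_edges. S_ext w = y} = {dih j False (G (of_real x)), dih j True (G (of_real x))}"
  proof
    show "{w \<in> outer_edges. S_ext w = y} \<subseteq> {dih j False (G (of_real x)), dih j True (G (of_real x))}"
    proof
      fix w assume w: "w \<in> {w \<in> outer_edges. S_ext w = y}"
      then obtain i d x' where x': "1 < x'" "w = dih i d (G (of_real x'))" by (auto simp: outer_edges_def)
      then have e: "dih i False (of_real x') = dih j False (of_real x)" using w x by (simp add: dih_slit_value)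
      then have "(of_real x' :: complex) = of_real x" using dih_eq(1)[OF _ _ e] x x' by simp
      then have xx: "x' = x" by simp
      then have "cis (2 * a * of_int i) = cis (2 * a * of_int j)" using e x by (simp add: dih_def)
      then have "w = dih j d (G (of_real x))" using x' xx by (simp add: dih_def)
      then show "w \<in> {dih j False (G (of_real x)), dih j True (G (of_real x))}" by (cases d) auto
    qed
    show "{dih j False (G (of_real x)), dih j True (G (of_real x))} \<subseteq> {w \<in> outer_edges. S_ext w = y}"
      using x dih_slit_value[of x j] outer_edges_I[of x j] by simp
  qed
  moreover have "dih j False (G (of_real x)) \<noteq> dih j True (G (of_real x))"
  proof
    assume "dih j False (G (of_real x)) = dih j True (G (of_real x))"
    then have "G (of_real x) = cnj (G (of_real x))" by (simp add: dih_def)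
    then have "Im (G (of_real x)) = Im (cnj (G (of_real x)))" by (rule arg_cong)
    then show False using G_slit_Im[OF x(1)] by simp
  qed
  ultimately show "card {w \<in> outer_edges. S_ext w = y} = 2" by simp
qed

lemma S_ext_cont_closure:
  "continuous_on (if k = 1 then closure image_F else closure image_F - rotations n {pt_P n k}) S_ext"
proof (rule continuous_on_subset[OF S_ext_cont])
  show "(if k = 1 then closure image_F else closure image_F - rotations n {pt_P n k}) \<subseteq> star'"
  proof
    fix w assume w: "w \<in> (if k = 1 then closure image_F else closure image_F - rotations n {pt_P n k})"
    then have "w \<in> closure image_F" by (simp split: if_splits)
    then have "w \<in> star" using closure_image_F by simp
    then obtain j e u where u: "j \<in> {0..<int n}" "u \<in> piece" "w = dih j e u" unfolding star_def by blast
    have "u \<in> piece'"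
    proof (rule ccontr)
      assume "u \<notin> piece'"
      then have *: "k > 1" "u = pt_P n k" using u k1 by (auto simp: piece'_def)
      obtain i where "dih j e u = dih i False u" 
        using dih_False[of u j e] refl_on_axis[OF ht_pt_P] * by auto
      then have "w \<in> rotations n {pt_P n k}" using u * rotations_I[of u "{pt_P n k}" i] by simp
      then show False using w * by simp
    qed
    then show "w \<in> star'" using u unfolding star'_def by blast
  qed
qed

lemma S_ext_vertex: "S_ext (omega n powi j * of_real (phi n k)) = omega n powi j"
  using S_ext_dih[of 1 j False] by (simp add: omega_powi dih_def G_1)

text \<open>A slit point \<open>y\<close> is approached from both sides, so its two preimages are limits of
  \<open>F\<close>-values. If \<open>h\<close> were injective on \<open>D \<ni> p\<close>, then by the open mapping theorem
  points of both sides would have their only preimage near \<open>p\<close>, contradicting the other limit.\<close>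

lemma image_F_maximal:
  assumes D: "image_F \<subset> D" "open D" "connected D" and h: "h holomorphic_on D" "\<And>z. z \<in> image_F \<Longrightarrow> h z = S_ext z"
  shows "\<not> inj_on h D"
proof
  assume inj: "inj_on h D"
  have "0 \<in> image_F" using zero_slit_plane F_0 unfolding image_F_def by (metis imageI)
  then have "D \<inter> frontier image_F \<noteq> {}" using D by (intro connected_Int_frontier) auto
  then obtain q where q: "q \<in> D" "q \<in> star" "q \<notin> image_F" by (auto simp: frontier_image_F)
  then obtain j e u where u: "u \<in> piece" "q = dih j e u" by (auto simp: star_iff)
  define N where "N = {v. dih j e v \<in> D}"
  have N: "open N" 
  proof -
    have "open (dih j e -` D)" by (intro open_vimage continuous_on_dih continuous_on_id D)
    then show ?thesis by (simp add: N_def vimage_def)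
  qed
  have uN: "u \<in> N" using q u by (simp add: N_def)
  \<comment> \<open>The frontier point found may be a vertex; outer edge points accumulate at A and
    at P, so an edge point is available in any case.\<close>
  have "\<exists>x>1. G (of_real x) \<in> N"
    using u(1)
  proof (cases rule: piece_cases)
    case (1 z)
    then show ?thesis using q u image_F_I[of z j e] by simp
  next
    case (2 x)
    show ?thesis
    proof (cases "x = 1")
      case True
      then have "\<forall>\<^sub>F x in at_right 1. G (of_real x) \<in> N"
        using 2 uN N G_slit_tendsto_A by (auto dest: topological_tendstoD)
      then have "\<forall>\<^sub>F x in at_right 1. G (of_real x) \<in> N \<and> 1 < x"
        by (intro eventually_conj eventually_at_right_less)
      then show ?thesis using eventually_happens'[OF trivial_limit_at_right_real] by blast
    next
      case False
      then show ?thesis using 2 uN by (intro exI[of _ x]) auto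
    qed
  next
    case 3
    then have "\<forall>\<^sub>F x in at_top. G (of_real x) \<in> N"
      using uN N G_slit_tendsto_P by (auto dest: topological_tendstoD)
    then have "\<forall>\<^sub>F x in at_top. G (of_real x) \<in> N \<and> 1 < x"
      by (intro eventually_conj eventually_gt_at_top)
    then show ?thesis using eventually_happens'[OF trivial_limit_at_top_linorder] by blast
  qed
  then obtain x where x: "1 < x" "G (of_real x) \<in> N" by blast
  define p where "p = dih j e (G (of_real x))"
  define p2 where "p2 = dih j (\<not> e) (G (of_real x))"
  define y where "y = dih j False (of_real x)"
  have pD: "p \<in> D" using x by (simp add: p_def N_def)
  have pp2: "p \<noteq> p2"
  proof
    assume "p = p2"
    then have "G (of_real x) = cnj (G (of_real x))" by (cases e) (auto simp: dih_def p_def p2_def)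
    then have "Im (G (of_real x)) = Im (cnj (G (of_real x)))" by (rule arg_cong)
    then show False using G_slit_Im[OF x(1)] by simp
  qed
  \<comment> \<open>A path in the half-sector tending to the slit point; under the symmetries with
    flags \<open>e\<close> and \<open>\<not> e\<close> it approaches \<open>y\<close> from the two
    sides.\<close>
  define z where "z t = of_real x * cis t" for t
  have zt: "((\<lambda>t. z t) \<longlongrightarrow> of_real x) (at_right 0)"
    unfolding z_def by (auto intro!: tendsto_eq_intros)
  have Gz: "((\<lambda>t. G (z t)) \<longlongrightarrow> G (of_real x)) (at_right 0)"
  proof -
    have "continuous_on {0..a} (\<lambda>t. G (z t))"
      unfolding z_def using x by (intro continuous_on_compose2[OF G_cont] continuous_intros) (auto intro!: sector_polar_intro)
    then have "\<forall>t\<in>{0..a}. ((\<lambda>t. G (z t)) \<longlongrightarrow> G (z t)) (at t within {0..a})"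
      by (simp only: continuous_on_def)
    then have "((\<lambda>t. G (z t)) \<longlongrightarrow> G (z 0)) (at 0 within {0..a})" by (rule bspec) (use a_pos in simp)
    then show ?thesis using at_within_Icc_at_right[OF a_pos] by (simp add: z_def)
  qed
  have small: "\<forall>\<^sub>F t in at_right 0. 0 < t \<and> t < a"
    using a_pos by (auto simp: eventually_at_right_field)
  have image_F_z: "dih j d (G (z t)) \<in> image_F \<and> h (dih j d (G (z t))) = dih j d (z t)" if "0 < t \<and> t < a" for d t
  proof -
    have zS: "z t \<in> sector" using that x by (auto simp: z_def intro!: sector_polar_intro)
    have "0 < sin t" using that a_lt_pi2 by (intro sin_gt_zero) auto
    then have "0 < Im (z t)" using x(1) by (simp add: z_def)
    then have "z t \<notin> of_real ` {1..}" by auto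
    then have "dih j d (G (z t)) \<in> image_F" using zS by (intro image_F_I)
    then show ?thesis using h(2) S_ext_dih[OF zS] by simp
  qed
  have hp: "h p = y"
  proof -
    have "((\<lambda>t. dih j e (G (z t))) \<longlongrightarrow> p) (at_right 0)"
      unfolding p_def by (intro tendsto_dih Gz)
    moreover have "isCont h p"
      using h(1) D(2) pD holomorphic_on_imp_continuous_on continuous_on_eq_continuous_at by blast
    ultimately have "((\<lambda>t. h (dih j e (G (z t)))) \<longlongrightarrow> h p) (at_right 0)"
      by (rule isCont_tendsto_compose[rotated])
    moreover have "((\<lambda>t. h (dih j e (G (z t)))) \<longlongrightarrow> dih j e (of_real x)) (at_right 0)"
    proof (rule Lim_transform_eventually[OF tendsto_dih[OF zt]])
      show "\<forall>\<^sub>F t in at_right 0. dih j e (z t) = h (dih j e (G (z t)))"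
        using small by eventually_elim (simp add: image_F_z)
    qed
    ultimately have "h p = dih j e (of_real x)"
      using tendsto_unique[OF trivial_limit_at_right_real] by blast
    then show ?thesis using dih_of_real[of j e x] by (simp add: y_def)
  qed
  \<comment> \<open>Small enough to be separated from points near \<open>p2\<close>. The point
    \<open>p2\<close> itself may lie outside \<open>D\<close>, as only nearby points of
    \<open>image_F\<close> are used.\<close>
  define U where "U = D \<inter> ball p (dist p p2 / 2)"
  have U: "open U" "p \<in> U" "U \<subseteq> D" using D pD pp2 by (auto simp: U_def)
  have "open (h ` U)"
    using U h inj by (intro open_mapping_thm3 holomorphic_on_subset[OF h(1)]) (auto intro: inj_on_subset)
  moreover have "y \<in> h ` U" using U hp by blast
  moreover have "((\<lambda>t. dih j (\<not> e) (z t)) \<longlongrightarrow> y) (at_right 0)"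
    using tendsto_dih[OF zt, of j "\<not> e"] by (simp only: dih_of_real[of j "\<not> e"] y_def)
  ultimately have E1: "\<forall>\<^sub>F t in at_right 0. dih j (\<not> e) (z t) \<in> h ` U"
    by (auto dest: topological_tendstoD)
  have "((\<lambda>t. dih j (\<not> e) (G (z t))) \<longlongrightarrow> p2) (at_right 0)"
    unfolding p2_def by (intro tendsto_dih Gz)
  then have E2: "\<forall>\<^sub>F t in at_right 0. dist (dih j (\<not> e) (G (z t))) p2 < dist p p2 / 2"
    using pp2 by (intro tendstoD) auto
  have "\<forall>\<^sub>F t in at_right 0. dih j (\<not> e) (z t) \<in> h ` U \<and>
      dist (dih j (\<not> e) (G (z t))) p2 < dist p p2 / 2 \<and> 0 < t \<and> t < a"
    by (intro eventually_conj E1 E2 small)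
  then obtain t where t: "dih j (\<not> e) (z t) \<in> h ` U"
      "dist (dih j (\<not> e) (G (z t))) p2 < dist p p2 / 2" "0 < t \<and> t < a"
    using eventually_happens'[OF trivial_limit_at_right_real] by blast
  define r where "r = dih j (\<not> e) (G (z t))"
  have r: "r \<in> image_F" "h r = dih j (\<not> e) (z t)" using image_F_z[OF t(3)] by (auto simp: r_def)
  then obtain v where v: "v \<in> U" "h r = h v" using t(1) by auto
  \<comment> \<open>\<open>r\<close> near \<open>p2\<close> and \<open>v\<close> near
    \<open>p\<close> have the same value; injectivity merges them, which the triangle inequality
    forbids.\<close>
  then have "r = v" using inj_onD[OF inj, of r v] U r D(1) by auto
  then have "dist p r < dist p p2 / 2" using v by (simp add: U_def)
  moreover have "dist r p2 < dist p p2 / 2" using t(2) by (simp add: r_def)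
  ultimately show False using dist_triangle[of p p2 r] by linarith
qed

end

theorem theorem2:
  fixes n k :: nat
  assumes "2 < n" and "1 \<le> k" and "k < n"
  shows "\<exists>f. continues_S n k (Omega n k) f
    \<and> biholomorphism (Omega n k) (Sigma_slit n) f
    \<and> (\<exists>g.
         continuous_on
           (if k = 1 then closure (Omega n k) else closure (Omega n k) - rotations n {pt_P n k}) g
         \<and> (\<forall>z\<in>Omega n k. g z = f z)
         \<and> (\<forall>j::int. g (omega n powi j * complex_of_real (phi n k)) = omega n powi j)
         \<and> (k = 1 \<longrightarrow>
              two_to_one_onto g
                (frontier (Omega n k) - rotations n {complex_of_real (phi n k)})
                (rotations n (complex_of_real ` {1<..})))
         \<and> (k > 1 \<longrightarrow>
              two_to_one_onto g
                (frontier (Omega n k) - rotations n {complex_of_real (phi n k), pt_P n k})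
                (rotations n (complex_of_real ` {1<..}))))
    \<and> (\<forall>D h. Omega n k \<subset> D \<and> open D \<and> connected D \<and> h holomorphic_on D
           \<and> (\<forall>z\<in>Omega n k. h z = f z) \<longrightarrow> \<not> inj_on h D)"
proof -
  interpret sc_map n k by unfold_locales (fact assms)+
  have fr: "k = 1 \<Longrightarrow> frontier image_F - rotations n {complex_of_real (phi n k)} = outer_edges"
    "k > 1 \<Longrightarrow> frontier image_F - rotations n {complex_of_real (phi n k), pt_P n k} = outer_edges"
    by (rule frontier_outer_edges, simp)+
  show ?thesis
    unfolding Omega_eq
    by (intro exI[of _ S_ext] conjI allI impI ballI refl S_ext_continues S_ext_biholo S_ext_cont_closure S_ext_vertex)
      (use image_F_maximal S_ext_two_to_one fr in \<open>auto simp only:\<close>)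
qed

end
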